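(* For $t\geq 1$ let $h_t$ be the maximum order of the canonical group over all near-homogeneous face 2-coloured spherical triangulations whose underlying graphs are simple and which have $t$ faces of each colour. Then $$\limsup_{t\rightarrow\infty}(h_t)^{1/t}<\left(\exp\left(\ln(3)-\frac{2}{27}\right)\right)^{1/3}<1.4071.$$
   Context: A face 2-coloured spherical triangulation is a triangulation of the sphere whose faces are properly coloured black and white (faces sharing an edge have different colours). It is near-homogeneous if its underlying graph has exactly six vertices of degree four and all other vertices have degree six. With $V$ its vertex set, $\mathcal{A}_W$ is the abelian group generated by $V$ subject to $r+c+s=0$ for each white face with vertices $r,c,s$; then $\mathcal{A}_W\cong\mathbb{Z}\oplus\mathbb{Z}\oplus\mathcal{C}$ with $\mathcal{C}$ finite, called the canonical group. *)

theory Defs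
  imports
    Complex_Main
    "HOL-Library.Extended_Real"
    "HOL-Library.Liminf_Limsup"
    "HOL-Combinatorics.Orbits"
    "HOL-Algebra.Free_Abelian_Groups"
    "HOL-Algebra.Multiplicative_Group"
    "Graph_Theory.Digraph_Component"
    "Graph_Theory.Bidirected_Digraph"
begin

text \<open>
  Embedded graphs are described by rotation systems. The graph is a symmetric digraph in which
  every undirected edge, loop or not, is a pair of opposite arcs \<open>a\<close>, \<open>arev a\<close>, and \<open>rot\<close>
  rotates the arcs leaving each vertex into their cyclic order in an orientation of the surface.
  Crossing \<open>a\<close> and then turning to the next arc at its head walks along the boundary of a face,
  so a face is identified with the set of arcs on its boundary, all traversed in the same sense.
\<close>

definition face_of :: "('b \<Rightarrow> 'b) \<Rightarrow> ('b \<Rightarrow> 'b) \<Rightarrow> 'b \<Rightarrow> 'b set" where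
  "face_of arev rot a = orbit (rot \<circ> arev) a"

definition faces :: "('a, 'b) pre_digraph \<Rightarrow> ('b \<Rightarrow> 'b) \<Rightarrow> ('b \<Rightarrow> 'b) \<Rightarrow> 'b set set" where
  "faces G arev rot = face_of arev rot ` arcs G"

definition edges :: "('a, 'b) pre_digraph \<Rightarrow> ('b \<Rightarrow> 'b) \<Rightarrow> 'b set set" where
  "edges G arev = (\<lambda>a. {a, arev a}) ` arcs G"

text \<open>
  The surface of a connected rotation system is orientable, so Euler characteristic 2
  characterises the sphere.
\<close>

locale spherical_triangulation = fin_digraph G + bidirected_digraph G arev
  for G :: "('a, 'b) pre_digraph" and arev :: "'b \<Rightarrow> 'b" +
  fixes rot :: "'b \<Rightarrow> 'b"
  assumes rot_permutes: "rot permutes arcs G"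
    and rot_cyclic: "v \<in> verts G \<Longrightarrow> cyclic_on rot (out_arcs G v)"
    and connected_graph: "connected G"
    and triangular: "f \<in> faces G arev rot \<Longrightarrow> card f = 3"
    and euler: "int (card (verts G)) - int (card (edges G arev))
                  + int (card (faces G arev rot)) = 2"

text \<open>\<open>W\<close> is the set of white faces; the remaining faces are black.\<close>

locale face_2_coloured_spherical_triangulation = spherical_triangulation G arev rot
  for G :: "('a, 'b) pre_digraph" and arev :: "'b \<Rightarrow> 'b" and rot :: "'b \<Rightarrow> 'b" +
  fixes W :: "'b set set"
  assumes white_faces: "W \<subseteq> faces G arev rot"
    and proper: "a \<in> arcs G \<Longrightarrow>
                   face_of arev rot a \<in> W \<longleftrightarrow> face_of arev rot (arev a) \<notin> W"

text \<open>
  As \<open>G\<close> contains both arcs of every edge, the degree of a vertex is its out-degree.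
\<close>

definition near_homogeneous :: "('a, 'b) pre_digraph \<Rightarrow> bool" where
  "near_homogeneous G \<longleftrightarrow>
     card {v \<in> verts G. out_degree G v = 4} = 6 \<and>
     (\<forall>v \<in> verts G. out_degree G v \<noteq> 4 \<longrightarrow> out_degree G v = 6)"

text \<open>
  The three arcs of a face start at its three vertices, so the inner sum below is the
  relator \<open>r + c + s\<close> of the face.
\<close>

definition white_group :: "('a, 'b) pre_digraph \<Rightarrow> 'b set set \<Rightarrow> ('a \<Rightarrow>\<^sub>0 int) set monoid" where
  "white_group G W =
     free_Abelian_group (verts G) Mod
       generate (free_Abelian_group (verts G)) ((\<lambda>f. \<Sum>a\<in>f. frag_of (tail G a)) ` W)"

text \<open>The canonical group is determined up to isomorphism only, hence a predicate.\<close>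

definition canonical_group :: "('a, 'b) pre_digraph \<Rightarrow> 'b set set \<Rightarrow> 'c monoid \<Rightarrow> bool" where
  "canonical_group G W C \<longleftrightarrow>
     comm_group C \<and> finite (carrier C) \<and>
     white_group G W \<cong> integer_group \<times>\<times> integer_group \<times>\<times> C"

lemma finite_part_card_le:
  assumes C: "group C" "finite (carrier C)" and D: "group D" "finite (carrier D)"
    and iso: "f \<in> iso (integer_group \<times>\<times> integer_group \<times>\<times> C)
                 (integer_group \<times>\<times> integer_group \<times>\<times> D)"
  shows "order C \<le> order D"
proof -
  interpret C: group C by fact
  interpret D: group D by fact
  let ?P = "integer_group \<times>\<times> integer_group \<times>\<times> C"
  let ?Q = "integer_group \<times>\<times> integer_group \<times>\<times> D"
  interpret P: group ?P by (intro DirProd_group group_integer_group C)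
  interpret Q: group ?Q by (intro DirProd_group group_integer_group D)
  have hom: "f \<in> hom ?P ?Q" and inj: "inj_on f (carrier ?P)"
    using iso by (auto simp: iso_def bij_betw_def)
  interpret group_hom ?P ?Q f using hom by unfold_locales
  have powC: "(0, 0, c) [^]\<^bsub>?P\<^esub> n = (0, 0, c [^]\<^bsub>C\<^esub> n)" for c and n :: nat
    by (induction n) (auto simp: nat_pow_def)
  have powD: "\<exists>y. (i, j, d) [^]\<^bsub>?Q\<^esub> n = (int n * i, int n * j, y)" for i j d and n :: nat
    by (induction n) (auto simp: nat_pow_def algebra_simps)
  have "f (0, 0, c) \<in> (\<lambda>d. (0, 0, d)) ` carrier D" if c: "c \<in> carrier C" for c
  proof -
    have cP: "(0, 0, c) \<in> carrier ?P" using c by simp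
    obtain i j d where f: "f (0, 0, c) = (i, j, d)" by (metis prod_cases3)
    have d: "d \<in> carrier D" using hom_closed[OF cP] f by simp
    have n: "order C > 0" using C by (simp add: C.order_gt_0_iff_finite)
    have "(i, j, d) [^]\<^bsub>?Q\<^esub> order C = f ((0, 0, c) [^]\<^bsub>?P\<^esub> order C)"
      using hom_nat_pow[OF cP] f by simp
    also have "\<dots> = f \<one>\<^bsub>?P\<^esub>"
      using C.pow_order_eq_1[OF c] powC by simp
    also have "\<dots> = (0, 0, \<one>\<^bsub>D\<^esub>)" using hom_one by simp
    finally have "i = 0 \<and> j = 0" using powD[of i j d "order C"] n by auto
    then show ?thesis using f d by auto
  qed
  then have "(\<lambda>c. f (0, 0, c)) ` carrier C \<subseteq> (\<lambda>d. (0, 0, d)) ` carrier D" by auto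
  moreover have "inj_on (\<lambda>c. f (0, 0, c)) (carrier C)"
    using inj by (auto simp: inj_on_def)
  ultimately have "card (carrier C) \<le> card ((\<lambda>d. (0::int, 0::int, d)) ` carrier D)"
    using D by (metis card_image card_mono finite_imageI)
  also have "\<dots> \<le> card (carrier D)" using D by (simp add: card_image_le)
  finally show ?thesis by (simp add: order_def)
qed

lemma (in face_2_coloured_spherical_triangulation) group_white_group:
  "group (white_group G W)"
proof -
  let ?F = "free_Abelian_group (verts G)"
  interpret F: comm_group ?F by (rule abelian_free_Abelian_group)
  have perm: "rot \<circ> arev permutes arcs G"
    using arev_permutes_arcs rot_permutes by (rule permutes_compose)
  have "f \<subseteq> arcs G" if f: "f \<in> W" for f
  proof -
    obtain a where a: "a \<in> arcs G" "f = orbit (rot \<circ> arev) a"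
      using f white_faces by (auto simp: faces_def face_of_def)
    have "x \<in> arcs G" if "x \<in> orbit (rot \<circ> arev) a" for x
      using that by induction (use a(1) permutes_in_image[OF perm] in auto)
    then show ?thesis using a(2) by blast
  qed
  then have "Poly_Mapping.keys (\<Sum>a\<in>f. frag_of (tail G a)) \<subseteq> verts G" if "f \<in> W" for f
    using that by (intro order_trans[OF keys_sum]) (auto, use tail_in_verts in blast)
  then have "(\<lambda>f. \<Sum>a\<in>f. frag_of (tail G a)) ` W \<subseteq> carrier ?F" by auto
  then show ?thesis
    unfolding white_group_def
    by (intro normal.factorgroup_is_group F.normal_iff_subgroup[THEN iffD2] F.generate_is_subgroup)
qed

lemma (in face_2_coloured_spherical_triangulation) canonical_group_order_unique:
  assumes "canonical_group G W C" "canonical_group G W D"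
  shows "order C = order D"
proof -
  have C: "group C" "finite (carrier C)" and D: "group D" "finite (carrier D)"
    using assms by (auto simp: canonical_group_def comm_group_def)
  let ?P = "integer_group \<times>\<times> integer_group \<times>\<times> C"
  let ?Q = "integer_group \<times>\<times> integer_group \<times>\<times> D"
  have "white_group G W \<cong> ?P" "white_group G W \<cong> ?Q"
    using assms by (auto simp: canonical_group_def)
  then have "?P \<cong> ?Q" "?Q \<cong> ?P"
    using group.iso_sym[OF group_white_group] iso_trans by blast+
  then obtain f g where "f \<in> iso ?P ?Q" "g \<in> iso ?Q ?P"
    by (auto simp: is_iso_def)
  then show ?thesis
    using finite_part_card_le[OF C D] finite_part_card_le[OF D C] by (meson le_antisym)
qed

text \<open>
  Every finite triangulation, and every finite group, has an isomorphic copy on natural numbers.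
  On \<open>nat\<close>, \<open>Sup\<close> is the maximum of a finite nonempty set; it is 0 for the empty set, which
  fixes a value for the \<open>t\<close> without any such triangulation.
\<close>

definition max_canonical_order :: "nat \<Rightarrow> nat" where
  "max_canonical_order t =
     Sup {order C | (C :: nat monoid) (G :: (nat, nat) pre_digraph) arev rot W.
            face_2_coloured_spherical_triangulation G arev rot W \<and>
            near_homogeneous G \<and> graph G \<and>
            card W = t \<and> card (faces G arev rot - W) = t \<and>
            canonical_group G W C}"

end

theory Submission
  imports "Jordan_Normal_Form.Determinant" Defs
begin

text \<open>
  Join the two vertices that face each other across an edge by an arc from the apex of the white
  face to that of the black face. White relators make the vertices harmonic for this digraph, which
  is Eulerian, so real-valued solutions of the white relations are constant on its components. As
  there are two more vertices than white faces, the solution space has dimension at least two, and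
  this forces exactly three components, meeting every face once. Let \<open>R\<close> be the smallest of them;
  it has \<open>n \<le> (t + 2) / 3\<close> vertices.

  Modulo the free part, the differences of the vertices of \<open>R\<close> generate the canonical group, and
  they satisfy the relations given by the rows of the Laplacian of \<open>R\<close> with a root removed. So the
  order is at most the determinant of that matrix. Gaussian elimination writes the determinant as a
  product of pivots, and each closed walk of length three lowers the pivot of its last vertex by at
  least \<open>1 / 9\<close> from at most \<open>3\<close>. Walking around a vertex of degree six outside \<open>R\<close> gives such a
  closed walk, so there are at least \<open>2 t / 3 - O(1)\<close> of them. As \<open>3 - N / 9 \<le> 3 (26 / 27) ^ N\<close>, the
  order is \<open>O(b ^ t)\<close> with \<open>b = (3 (26 / 27)\<^sup>2) powr (1 / 3)\<close>, and \<open>26 / 27 < exp (- 1 / 27)\<close>.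
\<close>

section \<open>Lattices generated by the rows of a matrix\<close>

text \<open>A subgroup of the integer lattice of rank \<open>m\<close>, held as a predicate on
  functions; \<open>cong\<close> makes the entries from index \<open>m\<close> on
  irrelevant.\<close>

locale int_lattice =
  fixes m :: nat and L :: "(nat \<Rightarrow> int) \<Rightarrow> bool"
  assumes zero: "L (\<lambda>k. 0)"
    and sub: "L u \<Longrightarrow> L v \<Longrightarrow> L (\<lambda>k. u k - v k)"
    and cong: "L u \<Longrightarrow> (\<And>k. k < m \<Longrightarrow> u k = v k) \<Longrightarrow> L v"
begin

lemma minus: "L u \<Longrightarrow> L (\<lambda>k. - u k)"
  using sub[OF zero, of u] by simp

lemma add: "L u \<Longrightarrow> L v \<Longrightarrow> L (\<lambda>k. u k + v k)"
  using sub[OF _ minus, of u v] by simp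

lemma scale: 
  assumes "L u"
  shows "L (\<lambda>k. c * u k)"
proof -
  have *: "L (\<lambda>k. int n * u k)" for n
    by (induction n) (use zero add[OF assms] in \<open>simp_all add: distrib_right\<close>)
  show ?thesis
    using *[of "nat c"] minus[OF *[of "nat (- c)"]] by (cases "c \<ge> 0") simp_all
qed

lemma combination:
  assumes "finite I" "\<And>i. i \<in> I \<Longrightarrow> L (f i)"
  shows "L (\<lambda>k. \<Sum>i\<in>I. c i * f i k)"
  using assms by (induction I rule: finite_induct) (simp_all add: zero add scale)

lemma row_of_product:
  assumes M: "M \<in> carrier_mat m m" and X: "X \<in> carrier_mat m m"
    and rows: "\<And>i. i < m \<Longrightarrow> L (\<lambda>k. M $$ (i, k))" and i: "i < m"
  shows "L (\<lambda>k. (X * M) $$ (i, k))"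
proof (rule cong)
  show "L (\<lambda>k. \<Sum>j\<in>{0..<m}. X $$ (i, j) * M $$ (j, k))"
    by (rule combination) (use rows i in auto)
  show "(\<Sum>j\<in>{0..<m}. X $$ (i, j) * M $$ (j, k)) = (X * M) $$ (i, k)" if "k < m" for k
    using M X i that by (auto simp: scalar_prod_def)
qed

text \<open>\<open>L\<close> has a triangular basis \<open>H\<close>. Its diagonal gives a system of representatives, and \<open>M\<close> is
  an integral multiple of \<open>H\<close>.\<close>

lemma index_le_det:
  assumes M: "M \<in> carrier_mat m m" and det: "det M \<noteq> 0"
    and rows: "\<And>i. i < m \<Longrightarrow> L (\<lambda>k. M $$ (i, k))"
  obtains S where "finite S" "int (card S) \<le> \<bar>det M\<bar>" "\<And>v. \<exists>s\<in>S. L (\<lambda>k. v k - s k)"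
proof -
  \<comment> \<open>Possible leading entries at position \<open>k\<close>; the least positive one
    becomes the diagonal entry of a Hermite-style basis.\<close>
  define D where "D k a \<longleftrightarrow> (\<exists>v. L v \<and> (\<forall>i<k. v i = 0) \<and> v k = int a)" for k a
  have ex: "\<exists>a>0. D k a" if k: "k < m" for k
  proof -
    let ?v = "\<lambda>i. if i = k then det M else 0"
    \<comment> \<open>The adjugate times \<open>M\<close> is \<open>det M\<close> times the
      identity, so \<open>L\<close> contains a nonzero multiple of every unit vector.\<close>
    have "L (\<lambda>i. (adj_mat M * M) $$ (k, i))"
      using row_of_product[OF M _ rows k] adj_mat(1)[OF M] by blast
    then have "L (\<lambda>i. if k = i then det M else 0)"
      by (rule cong) (use adj_mat[OF M] k in auto)
    then have v: "L ?v" by (rule cong) auto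
    have "L (\<lambda>i. sgn (det M) * ?v i)" by (rule scale[OF v])
    then have "D k (nat \<bar>det M\<bar>)" unfolding D_def
      by (intro exI[of _ "\<lambda>i. sgn (det M) * ?v i"]) (auto simp: mult_sgn_abs abs_sgn[symmetric] linorder_not_le mult.commute)
    then show ?thesis using det by (intro exI[of _ "nat \<bar>det M\<bar>"]) simp
  qed
  define a where "a k = (LEAST a. a > 0 \<and> D k a)" for k
  have a: "a k > 0" "D k (a k)" if "k < m" for k
    using LeastI_ex[OF ex[OF that]] unfolding a_def by auto
  have a_le: "a k \<le> b" if "b > 0" "D k b" for k b
    using that unfolding a_def by (intro Least_le) auto
  have "\<forall>k. \<exists>v. k < m \<longrightarrow> L v \<and> (\<forall>i<k. v i = 0) \<and> v k = int (a k)"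
    using a(2) unfolding D_def by blast
  from choice[OF this] obtain H where "\<forall>k. k < m \<longrightarrow> L (H k) \<and> (\<forall>i<k. H k i = 0) \<and> H k k = int (a k)"
    by blast
  then have H: "\<And>k. k < m \<Longrightarrow> L (H k)" "\<And>k i. k < m \<Longrightarrow> i < k \<Longrightarrow> H k i = 0"
      "\<And>k. k < m \<Longrightarrow> H k k = int (a k)"
    by blast+
  \<comment> \<open>Otherwise the remainder modulo \<open>a k\<close> would be a smaller positive
    leading entry.\<close>
  have dvd: "int (a k) dvd v k" if k: "k < m" and v: "L v" "\<forall>i<k. v i = 0" for k v
  proof (rule ccontr)
    assume n: "\<not> int (a k) dvd v k"
    let ?r = "v k mod int (a k)"
    have "?r \<noteq> 0" using n by (simp add: dvd_eq_mod_eq_0)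
    then have r: "0 < ?r" "?r < int (a k)"
      using a(1)[OF k] pos_mod_sign[of "int (a k)" "v k"] pos_mod_bound[of "int (a k)" "v k"]
      by linarith+
    have "L (\<lambda>i. v i - (v k div int (a k)) * H k i)"
      by (intro sub scale v H k)
    moreover have "v i - (v k div int (a k)) * H k i = 0" if "i < k" for i
      using v(2) H(2)[OF k that] that by simp
    moreover have "v k - (v k div int (a k)) * H k k = int (nat ?r)"
      unfolding H(3)[OF k] minus_div_mult_eq_mod using r by simp
    ultimately have "D k (nat ?r)" unfolding D_def by blast
    then show False using a_le[of "nat ?r" k] r by linarith
  qed
  have span: "\<exists>q. \<forall>j<m. v j = (\<Sum>l\<in>{k..<m}. q l * H l j)"
    if "k \<le> m" "L v" "\<forall>i<k. v i = 0" for k v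
    using that
  proof (induction k arbitrary: v rule: inc_induct)
    case base
    then show ?case by auto
  next
    case (step k)
    obtain c where c: "v k = int (a k) * c" using dvd[OF step(2,4,5)] by auto
    let ?w = "\<lambda>i. v i - c * H k i"
    have "L ?w" by (intro sub scale step H)
    moreover have "\<forall>i<Suc k. ?w i = 0"
      using step H(2,3)[OF step(2)] c by (auto simp: less_Suc_eq)
    ultimately obtain q where q: "\<forall>j<m. ?w j = (\<Sum>l\<in>{Suc k..<m}. q l * H l j)"
      using step(3) by blast
    have "v j = (\<Sum>l\<in>{k..<m}. (q(k := c)) l * H l j)" if "j < m" for j
    proof -
      have "(\<Sum>l\<in>{k..<m}. (q(k := c)) l * H l j) = c * H k j + (\<Sum>l\<in>{Suc k..<m}. (q(k := c)) l * H l j)"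
        using step(2) by (subst sum.atLeast_Suc_lessThan) auto
      also have "(\<Sum>l\<in>{Suc k..<m}. (q(k := c)) l * H l j) = ?w j"
        using q that by (auto intro!: sum.cong)
      finally show ?thesis by simp
    qed
    then show ?case by blast
  qed
  have "\<forall>i. \<exists>q. i < m \<longrightarrow> (\<forall>j<m. M $$ (i, j) = (\<Sum>l\<in>{0..<m}. q l * H l j))"
    using span[of 0] rows by auto
  from choice[OF this] obtain Q where Q: "\<And>i j. i < m \<Longrightarrow> j < m \<Longrightarrow> M $$ (i, j) = (\<Sum>l\<in>{0..<m}. Q i l * H l j)"
    by blast
  define X where "X = mat m m (\<lambda>(i, l). Q i l)"
  define T where "T = mat m m (\<lambda>(l, j). H l j)"
  have "M = X * T"
    using M Q by (intro eq_matI) (auto simp: X_def T_def scalar_prod_def)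
  moreover have "det T = (\<Prod>k<m. int (a k))"
    by (subst det_upper_triangular[of _ m])
      (auto simp: T_def upper_triangular_def H prod_list_diag_prod lessThan_atLeast0)
  \<comment> \<open>\<open>det X\<close> is a nonzero integer, so its absolute value is at least
    one.\<close>
  ultimately have "\<bar>det M\<bar> = \<bar>det X\<bar> * (\<Prod>k<m. int (a k))" "det X \<noteq> 0"
    using det det_mult[of X m T] by (auto simp: X_def T_def abs_mult abs_prod)
  moreover have "(\<Prod>k<m. int (a k)) \<ge> 0" by (simp add: prod_nonneg)
  ultimately have le: "(\<Prod>k<m. int (a k)) \<le> \<bar>det M\<bar>"
    using mult_right_mono[of 1 "\<bar>det X\<bar>" "\<Prod>k<m. int (a k)"] by simp
  \<comment> \<open>Reducing coordinate \<open>k\<close> modulo \<open>a k\<close> by a multiple of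
    \<open>H k\<close> leaves the coordinates before \<open>k\<close> unchanged.\<close>
  have reduce: "\<exists>s. L (\<lambda>i. v i - s i) \<and> (\<forall>i<k. 0 \<le> s i \<and> s i < int (a i))" if "k \<le> m" for k v
    using that
  proof (induction k)
    case 0
    show ?case using zero by (intro exI[of _ v]) simp
  next
    case (Suc k)
    then obtain s where s: "L (\<lambda>i. v i - s i)" "\<forall>i<k. 0 \<le> s i \<and> s i < int (a i)" by auto
    have k: "k < m" using Suc by simp
    let ?s = "\<lambda>i. s i - (s k div int (a k)) * H k i"
    have "L (\<lambda>i. (v i - s i) + (s k div int (a k)) * H k i)"
      by (intro add scale s H k)
    then have "L (\<lambda>i. v i - ?s i)" by (simp add: algebra_simps)
    moreover have "0 \<le> ?s i \<and> ?s i < int (a i)" if "i < Suc k" for i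
    proof (cases "i = k")
      case True
      have "?s k = s k mod int (a k)" unfolding H(3)[OF k] by (rule minus_div_mult_eq_mod)
      then show ?thesis using a(1)[OF k] True by simp
    next
      case False
      then show ?thesis using that s(2) H(2)[OF k, of i] by simp
    qed
    ultimately show ?case by (intro exI[of _ ?s] conjI allI impI; blast)
  qed
  let ?S = "PiE {..<m} (\<lambda>k. {0..<int (a k)})"
  have "\<exists>s\<in>?S. L (\<lambda>k. v k - s k)" for v
  proof -
    obtain s where s: "L (\<lambda>i. v i - s i)" "\<forall>i<m. 0 \<le> s i \<and> s i < int (a i)"
      using reduce[of m v] by auto
    \<comment> \<open>Members of \<open>PiE\<close> are \<open>undefined\<close> from
      \<open>m\<close> on, which \<open>cong\<close> absorbs.\<close>
    have "L (\<lambda>k. v k - restrict s {..<m} k)" by (rule cong[OF s(1)]) simp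
    then show ?thesis using s(2) by (intro bexI[of _ "restrict s {..<m}"]) auto
  qed
  moreover have "finite ?S" by (intro finite_PiE) auto
  moreover have "int (card ?S) \<le> \<bar>det M\<bar>" using le by (simp add: card_PiE)
  ultimately show ?thesis using that by blast
qed

end

section \<open>Determinants of monotone matrices\<close>

text \<open>Cramer's rule, with the adjugate divided by the determinant as inverse.\<close>

lemma solve_linear_system:
  fixes B :: "'a::field mat"
  assumes B: "B \<in> carrier_mat k k" and det: "det B \<noteq> 0"
  obtains u where "\<And>i. i < k \<Longrightarrow> (\<Sum>j<k. B $$ (i, j) * u j) = a i"
proof -
  define w where "w = inverse (det B) \<cdot>\<^sub>v (adj_mat B *\<^sub>v vec k a)"
  have w: "w \<in> carrier_vec k" using adj_mat(1)[OF B] by (auto simp: w_def)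
  have "B *\<^sub>v w = inverse (det B) \<cdot>\<^sub>v ((B * adj_mat B) *\<^sub>v vec k a)"
    using B adj_mat(1)[OF B] by (simp add: w_def mult_mat_vec[of _ k k] assoc_mult_mat_vec[of _ k k _ k])
  also have "\<dots> = vec k a"
    using det by (intro eq_vecI) (auto simp: adj_mat(2)[OF B])
  finally have *: "B *\<^sub>v w = vec k a" .
  have "(\<Sum>j<k. B $$ (i, j) * w $ j) = a i" if "i < k" for i
  proof -
    have "(\<Sum>j<k. B $$ (i, j) * w $ j) = (B *\<^sub>v w) $ i"
      using B w that by (auto simp: scalar_prod_def lessThan_atLeast0)
    then show ?thesis using * that by simp
  qed
  then show ?thesis using that by blast
qed

lemma det_eq_0_iff_kernel:
  fixes B :: "'a::field mat"
  assumes B: "B \<in> carrier_mat k k"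
  shows "det B = 0 \<longleftrightarrow> (\<exists>u. (\<exists>i<k. u i \<noteq> 0) \<and> (\<forall>i<k. (\<Sum>j<k. B $$ (i, j) * u j) = 0))"
proof -
  have *: "B *\<^sub>v w = 0\<^sub>v k \<longleftrightarrow> (\<forall>i<k. (\<Sum>j<k. B $$ (i, j) * w $ j) = 0)" if "w \<in> carrier_vec k" for w
    using B that by (auto simp: vec_eq_iff scalar_prod_def lessThan_atLeast0)
  show ?thesis
    unfolding det_0_iff_vec_prod_zero_field[OF B]
  proof safe
    fix v assume "v \<in> carrier_vec k" "v \<noteq> 0\<^sub>v k" "B *\<^sub>v v = 0\<^sub>v k"
    then show "\<exists>u. (\<exists>i<k. u i \<noteq> 0) \<and> (\<forall>i<k. (\<Sum>j<k. B $$ (i, j) * u j) = 0)"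
      using * by (intro exI[of _ "\<lambda>i. v $ i"]) (auto simp: vec_eq_iff)
  next
    fix u i assume "i < k" "u i \<noteq> 0" "\<forall>i<k. (\<Sum>j<k. B $$ (i, j) * u j) = 0"
    then show "\<exists>v. v \<in> carrier_vec k \<and> v \<noteq> 0\<^sub>v k \<and> B *\<^sub>v v = 0\<^sub>v k"
      using * by (intro exI[of _ "vec k u"]) (auto simp: vec_eq_iff)
  qed
qed

text \<open>Multiplying by the unipotent matrix \<open>U\<close> clears the last column above the
  diagonal. The corner then holds the Schur complement, that is, the last pivot.\<close>

lemma det_schur_last:
  fixes M :: "'a::field mat"
  assumes M: "M \<in> carrier_mat (Suc k) (Suc k)"
    and u: "\<And>i. i < k \<Longrightarrow> (\<Sum>j<k. M $$ (i, j) * u j) = - M $$ (i, k)"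
  shows "det M = det (mat k k (\<lambda>(i, j). M $$ (i, j))) * (M $$ (k, k) + (\<Sum>j<k. M $$ (k, j) * u j))"
proof -
  define U where "U = mat (Suc k) (Suc k) (\<lambda>(i, j). if i = j then 1 else if j = k then u i else 0)"
  let ?B = "mat k k (\<lambda>(i, j). M $$ (i, j))"
  let ?p = "M $$ (k, k) + (\<Sum>j<k. M $$ (k, j) * u j)"
  let ?r = "mat 1 k (\<lambda>(i, j). M $$ (k, j))"
  have U: "U \<in> carrier_mat (Suc k) (Suc k)" by (simp add: U_def)
  have detU: "det U = 1"
    by (subst det_upper_triangular[of _ "Suc k"]) (auto simp: U_def upper_triangular_def prod_list_diag_prod)
  have "M * U = four_block_mat ?B (0\<^sub>m k 1) ?r (mat 1 1 (\<lambda>_. ?p))" (is "_ = ?F")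
  proof (rule eq_matI)
    fix i j assume "i < dim_row ?F" "j < dim_col ?F"
    then have ij: "i < Suc k" "j < Suc k" by auto
    have "(M * U) $$ (i, j) = (\<Sum>l<Suc k. M $$ (i, l) * U $$ (l, j))"
      using M U ij by (auto simp: scalar_prod_def lessThan_atLeast0)
    also have "\<dots> = (if j = k then M $$ (i, k) + (\<Sum>l<k. M $$ (i, l) * u l) else M $$ (i, j))"
    proof (cases "j = k")
      case True
      then show ?thesis by (auto simp: U_def intro!: sum.cong)
    next
      case False
      then have "(\<Sum>l<Suc k. M $$ (i, l) * U $$ (l, j)) = (\<Sum>l<Suc k. if l = j then M $$ (i, j) else 0)"
        using ij by (intro sum.cong) (auto simp: U_def)
      then show ?thesis using False ij by simp
    qed
    also have "\<dots> = ?F $$ (i, j)"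
      using ij u[of i] by (auto simp: less_Suc_eq)
    finally show "(M * U) $$ (i, j) = ?F $$ (i, j)" .
  qed (use M U in auto)
  then have "det (M * U) = det ?B * det (mat 1 1 (\<lambda>_. ?p))"
    by (simp add: det_four_block_mat_upper_right_zero_col[of _ k])
  then show ?thesis using det_mult[OF M U] detU by (simp add: det_single)
qed

text \<open>The monotonicity hypothesis says that every leading principal submatrix has a
  nonnegative inverse.\<close>

locale monotone_matrix =
  fixes m :: nat and d :: "nat \<Rightarrow> real" and A :: "nat \<Rightarrow> nat \<Rightarrow> real"
  assumes A_nonneg: "A i j \<ge> 0" and d_pos: "i < m \<Longrightarrow> d i > 0"
    and monotone: "k \<le> m \<Longrightarrow> (\<And>i. i < k \<Longrightarrow> (\<Sum>j<k. A i j * x j) \<le> d i * x i) \<Longrightarrow> i < k \<Longrightarrow> x i \<ge> 0"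
begin

definition leading :: "nat \<Rightarrow> real mat" where
  "leading k = mat k k (\<lambda>(i, j). (if i = j then d i else 0) - A i j)"

lemma leading_mult:
  "i < k \<Longrightarrow> (\<Sum>j<k. leading k $$ (i, j) * u j) = d i * u i - (\<Sum>j<k. A i j * u j)"
proof -
  assume i: "i < k"
  then have "(\<Sum>j<k. leading k $$ (i, j) * u j) = (\<Sum>j<k. (if j = i then d i * u i else 0) - A i j * u j)"
    by (intro sum.cong) (auto simp: leading_def algebra_simps)
  then show ?thesis using i by (simp add: sum_subtractf)
qed

text \<open>Monotonicity applies to a kernel vector and to its negative, so the vector
  vanishes.\<close>

lemma det_leading_nonzero: 
  assumes k: "k \<le> m"
  shows "det (leading k) \<noteq> 0"
proof
  assume "det (leading k) = 0"
  then obtain u i where u: "i < k" "u i \<noteq> 0" "\<forall>i<k. (\<Sum>j<k. leading k $$ (i, j) * u j) = 0"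
    using det_eq_0_iff_kernel[of "leading k" k] by (auto simp: leading_def)
  then have eq: "(\<Sum>j<k. A i j * u j) = d i * u i" if "i < k" for i
    using that leading_mult[OF that, of u] by simp
  have "u i \<ge> 0" by (rule monotone[OF k _ u(1)]) (simp add: eq)
  moreover have "- u i \<ge> 0" by (rule monotone[OF k _ u(1), of "\<lambda>j. - u j"]) (simp add: eq sum_negf)
  ultimately show False using u(2) by simp
qed

text \<open>The term subtracted from the last pivot counts the closed walks of length three based at
  \<open>k\<close> and otherwise below \<open>k\<close>.\<close>

lemma det_leading_Suc:
  assumes k: "k < m"
  obtains p where "det (leading (Suc k)) = det (leading k) * p" "p > 0"
    "p \<le> d k - (\<Sum>i<k. \<Sum>j<k. A k i * A i j * A j k / (d i * d j))"
proof -
  \<comment> \<open>The vector \<open>u\<close> obtained next clears the new column in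
    \<open>det_schur_last\<close>.\<close>
  have "det (leading k) \<noteq> 0" using k by (intro det_leading_nonzero) simp
  then obtain u where "\<And>i. i < k \<Longrightarrow> (\<Sum>j<k. leading k $$ (i, j) * u j) = A i k"
    using solve_linear_system[of "leading k" k "\<lambda>i. A i k"] by (auto simp: leading_def)
  then have u: "d i * u i = A i k + (\<Sum>j<k. A i j * u j)" if "i < k" for i
    using that leading_mult[OF that, of u] by (simp add: algebra_simps)
  have u0: "u i \<ge> 0" if "i < k" for i
    using that k by (intro monotone[of k u i]) (auto simp: u A_nonneg)
  \<comment> \<open>The equation for \<open>u\<close> is iterated: dropping its sum leaves walks of
    one arc, and inserting this bound into the sum gives the walks of two arcs in
    \<open>u2\<close>.\<close>
  have u1: "u i \<ge> A i k / d i" if "i < k" for i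
  proof -
    have "A i k \<le> d i * u i" using u[OF that] by (simp, intro sum_nonneg mult_nonneg_nonneg A_nonneg u0) simp
    then show ?thesis using d_pos[of i] that k by (simp add: field_simps)
  qed
  have u2: "u i \<ge> (\<Sum>j<k. A i j * A j k / (d i * d j))" if "i < k" for i
  proof -
    have "(\<Sum>j<k. A i j * (A j k / d j)) \<le> (\<Sum>j<k. A i j * u j)"
      by (intro sum_mono mult_left_mono) (auto simp: u1 A_nonneg)
    also have "\<dots> \<le> d i * u i" using u[OF that] A_nonneg by simp
    finally have "(\<Sum>j<k. A i j * (A j k / d j)) / d i \<le> u i"
      using d_pos[of i] that k by (simp add: field_simps)
    then show ?thesis by (simp add: sum_divide_distrib mult.commute)
  qed
  define p where "p = d k - A k k - (\<Sum>i<k. A k i * u i)"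
  have "(\<Sum>j<k. leading (Suc k) $$ (i, j) * u j) = - leading (Suc k) $$ (i, k)" if "i < k" for i
  proof -
    have "(\<Sum>j<k. leading (Suc k) $$ (i, j) * u j) = (\<Sum>j<k. leading k $$ (i, j) * u j)"
      using that by (intro sum.cong) (auto simp: leading_def)
    also have "\<dots> = A i k" using leading_mult[OF that, of u] u[OF that] by simp
    finally show ?thesis using that by (simp add: leading_def)
  qed
  moreover have "mat k k (\<lambda>(i, j). leading (Suc k) $$ (i, j)) = leading k"
    by (auto simp: leading_def)
  moreover have "leading (Suc k) $$ (k, k) + (\<Sum>j<k. leading (Suc k) $$ (k, j) * u j) = p"
    by (simp add: leading_def p_def sum_negf)
  ultimately have det: "det (leading (Suc k)) = det (leading k) * p"
    using det_schur_last[of "leading (Suc k)" k u] by (simp add: leading_def)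
  have "p > 0"
  proof (rule ccontr)
    assume np: "\<not> p > 0"
    \<comment> \<open>If the pivot were not positive, this vector would satisfy the hypothesis of
      \<open>monotone\<close> while being negative at \<open>k\<close>.\<close>
    define x where "x i = (if i = k then - 1 else - u i)" for i
    have "x k \<ge> 0"
    proof (rule monotone[of "Suc k"])
      fix i assume i: "i < Suc k"
      have s: "(\<Sum>j<Suc k. A i j * x j) = - A i k - (\<Sum>j<k. A i j * u j)"
        by (simp add: x_def sum_negf)
      show "(\<Sum>j<Suc k. A i j * x j) \<le> d i * x i"
        using i np u[of i] unfolding s by (auto simp: x_def p_def less_Suc_eq)
    qed (use k in auto)
    then show False by (simp add: x_def)
  qed
  moreover have "p \<le> d k - (\<Sum>i<k. \<Sum>j<k. A k i * A i j * A j k / (d i * d j))"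
  proof -
    have "(\<Sum>i<k. A k i * (\<Sum>j<k. A i j * A j k / (d i * d j))) \<le> (\<Sum>i<k. A k i * u i)"
      by (intro sum_mono mult_left_mono) (auto simp: u2 A_nonneg)
    then show ?thesis using A_nonneg[of k k] by (simp add: p_def sum_distrib_left mult.assoc)
  qed
  ultimately show ?thesis using det that by blast
qed

lemma det_leading_le:
  assumes "k \<le> m"
  shows "0 < det (leading k)"
    and "det (leading k) \<le> (\<Prod>l<k. d l - (\<Sum>i<l. \<Sum>j<l. A l i * A i j * A j l / (d i * d j)))"
proof -
  have "0 < det (leading k) \<and> 
    det (leading k) \<le> (\<Prod>l<k. d l - (\<Sum>i<l. \<Sum>j<l. A l i * A i j * A j l / (d i * d j)))"
    using assms
  proof (induction k)
    case 0
    then show ?case by (simp add: leading_def)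
  next
    case (Suc k)
    then have k: "k < m" by simp
    obtain p where p: "det (leading (Suc k)) = det (leading k) * p" "p > 0"
        "p \<le> d k - (\<Sum>i<k. \<Sum>j<k. A k i * A i j * A j k / (d i * d j))"
      using det_leading_Suc[OF k] by blast
    then show ?case using Suc by (auto intro!: mult_mono)
  qed
  then show "0 < det (leading k)"
    "det (leading k) \<le> (\<Prod>l<k. d l - (\<Sum>i<l. \<Sum>j<l. A l i * A i j * A j l / (d i * d j)))"
    by auto
qed

end

section \<open>Arcs, faces and the across digraph\<close>

text \<open>A finite orbit is listed once by the iterates; applied to the three arcs of a face and
  to the six arcs at a vertex of degree six.\<close>

lemma orbit_funpow_card:
  assumes "x \<in> orbit f x"
  shows "(f ^^ card (orbit f x)) x = x"
    and "orbit f x = (\<lambda>n. (f ^^ n) x) ` {..<card (orbit f x)}"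
    and "inj_on (\<lambda>n. (f ^^ n) x) {..<card (orbit f x)}"
proof -
  have card: "card (orbit f x) = funpow_dist1 f x x"
    using assms by (subst orbit_conv_funpow_dist1) (auto simp: card_image inj_on_funpow_dist1)
  show "(f ^^ card (orbit f x)) x = x"
    unfolding card using assms by (rule funpow_dist1_prop)
  show "orbit f x = (\<lambda>n. (f ^^ n) x) ` {..<card (orbit f x)}"
    unfolding card lessThan_atLeast0 using assms by (rule orbit_conv_funpow_dist1)
  show "inj_on (\<lambda>n. (f ^^ n) x) {..<card (orbit f x)}"
    unfolding card lessThan_atLeast0 using assms by (rule inj_on_funpow_dist1)
qed

lemma bij_betw_if_mutual_inj:
  assumes "finite A" "finite B" "inj_on f A" "f ` A \<subseteq> B" "inj_on g B" "g ` B \<subseteq> A"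
  shows "bij_betw f A B"
proof -
  have "card A \<le> card B" "card B \<le> card A" using assms by (simp_all add: card_inj_on_le)
  then have "f ` A = B" using assms by (intro card_subset_eq) (auto simp: card_image)
  then show ?thesis using assms(3) by (simp add: bij_betw_def)
qed

context face_2_coloured_spherical_triangulation
begin

section \<open>The face permutation\<close>

definition nxt :: "'b \<Rightarrow> 'b" where "nxt a = rot (arev a)"

lemma nxt_permutes: "nxt permutes arcs G"
proof -
  have "nxt = rot \<circ> arev" by (auto simp: nxt_def)
  then show ?thesis using arev_permutes_arcs rot_permutes by (simp add: permutes_compose)
qed

lemma nxt_in_arcs [simp]: "nxt a \<in> arcs G \<longleftrightarrow> a \<in> arcs G"
  using permutes_in_image[OF nxt_permutes] .

lemma arev_in_arcs_iff [simp]: "arev a \<in> arcs G \<longleftrightarrow> a \<in> arcs G"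
  using permutes_in_image[OF arev_permutes_arcs] .

lemma rot_in_arcs [simp]: "rot a \<in> arcs G \<longleftrightarrow> a \<in> arcs G"
  using permutes_in_image[OF rot_permutes] .

lemma nxt_eq_iff [simp]: "nxt a = nxt b \<longleftrightarrow> a = b"
  using permutes_inj[OF nxt_permutes] by (auto dest: injD)

lemma rot_eq_iff [simp]: "rot a = rot b \<longleftrightarrow> a = b"
  using permutes_inj[OF rot_permutes] by (auto dest: injD)

lemma nxt_arev: "nxt (arev a) = rot a"
  by (simp add: nxt_def)

lemma face_of_eq_orbit: "face_of arev rot a = orbit nxt a"
  unfolding face_of_def by (rule arg_cong[of _ _ "\<lambda>f. orbit f a"]) (auto simp: nxt_def)

lemma self_in_orbit_nxt: "a \<in> orbit nxt a"
proof (rule permutation_self_in_orbit)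
  show "permutation nxt"
    unfolding permutation_permutes by (rule exI[of _ "arcs G"]) (simp add: nxt_permutes)
qed

lemma tail_rot [simp]: 
  assumes "a \<in> arcs G"
  shows "tail G (rot a) = tail G a"
proof -
  have "a \<in> out_arcs G (tail G a)" "tail G a \<in> verts G" using assms by auto
  then have "rot a \<in> out_arcs G (tail G a)" using cyclic_on_inI[OF rot_cyclic] by blast
  then show ?thesis by simp
qed

lemma tail_nxt [simp]: "a \<in> arcs G \<Longrightarrow> tail G (nxt a) = head G a"
  by (simp add: nxt_def)

lemma card_orbit_nxt: "a \<in> arcs G \<Longrightarrow> card (orbit nxt a) = 3"
  using triangular[of "face_of arev rot a"] by (auto simp: faces_def face_of_eq_orbit)

lemma nxt_nxt_nxt [simp]: "a \<in> arcs G \<Longrightarrow> nxt (nxt (nxt a)) = a"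
  using orbit_funpow_card(1)[OF self_in_orbit_nxt, of a] card_orbit_nxt[of a]
  by (simp add: eval_nat_numeral)

lemma head_nxt_nxt [simp]: "a \<in> arcs G \<Longrightarrow> head G (nxt (nxt a)) = tail G a"
  using tail_nxt[of "nxt (nxt a)"] by simp

lemma face_of_conv: 
  "a \<in> arcs G \<Longrightarrow> face_of arev rot a = {a, nxt a, nxt (nxt a)}"
  using orbit_funpow_card(2)[OF self_in_orbit_nxt, of a] card_orbit_nxt[of a]
  by (auto simp: face_of_eq_orbit eval_nat_numeral lessThan_Suc)

lemma nxt_distinct:
  assumes "a \<in> arcs G"
  shows "nxt a \<noteq> a" "nxt (nxt a) \<noteq> a"
proof -
  have "card {a, nxt a, nxt (nxt a)} = 3"
    using assms card_orbit_nxt[of a] face_of_conv[of a] by (simp add: face_of_eq_orbit)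
  then show "nxt a \<noteq> a" "nxt (nxt a) \<noteq> a" by (auto simp: card_insert_if split: if_splits)
qed

lemma face_of_nxt [simp]: "face_of arev rot (nxt a) = face_of arev rot a"
  unfolding face_of_eq_orbit using self_in_orbit_nxt by (rule self_in_orbit_step)

section \<open>Colours of arcs\<close>

definition white :: "'b \<Rightarrow> bool" where "white a \<longleftrightarrow> face_of arev rot a \<in> W"

lemma white_nxt [simp]: "white (nxt a) \<longleftrightarrow> white a"
  by (simp add: white_def)

lemma white_arev [simp]: "a \<in> arcs G \<Longrightarrow> white (arev a) \<longleftrightarrow> \<not> white a"
  unfolding white_def using proper[of a] by blast

lemma white_rot [simp]: "a \<in> arcs G \<Longrightarrow> white (rot a) \<longleftrightarrow> \<not> white a"
  using nxt_arev[of a] white_nxt[of "arev a"] by simp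

definition white_out :: "'a \<Rightarrow> 'b set" where "white_out v = {a \<in> out_arcs G v. white a}"
definition black_out :: "'a \<Rightarrow> 'b set" where "black_out v = {a \<in> out_arcs G v. \<not> white a}"

lemma finite_out [simp]: "finite (white_out v)" "finite (black_out v)"
  by (auto simp: white_out_def black_out_def)

text \<open>Consecutive arcs at a vertex lie in adjacent faces, so the colours alternate around
  it.\<close>

lemma bij_rot: "bij_betw rot (white_out v) (black_out v)" "bij_betw rot (black_out v) (white_out v)"
proof -
  have "rot ` white_out v \<subseteq> black_out v" "rot ` black_out v \<subseteq> white_out v" "inj_on rot S" for S
    by (auto simp: white_out_def black_out_def inj_on_def)
  then show "bij_betw rot (white_out v) (black_out v)" "bij_betw rot (black_out v) (white_out v)"
    by (auto intro!: bij_betw_if_mutual_inj[where g = rot])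
qed

lemma card_out: "card (white_out v) = card (black_out v)" "2 * card (black_out v) = out_degree G v"
proof -
  show *: "card (white_out v) = card (black_out v)" using bij_rot(1) by (rule bij_betw_same_card)
  have "out_arcs G v = white_out v \<union> black_out v" "white_out v \<inter> black_out v = {}"
    by (auto simp: white_out_def black_out_def)
  then have "out_degree G v = card (white_out v) + card (black_out v)"
    unfolding out_degree_def by (simp add: card_Un_disjoint)
  then show "2 * card (black_out v) = out_degree G v" using * by simp
qed

section \<open>The across digraph and its Laplacian\<close>

definition black :: "'b set" where "black = {a \<in> arcs G. \<not> white a}"

lemma finite_black [simp]: "finite black" by (simp add: black_def)

text \<open>The arc that the white face across the edge opposite to the tail of \<open>b\<close> has at the
  vertex facing that edge.\<close>

definition across :: "'b \<Rightarrow> 'b" where "across b = nxt (nxt (arev (nxt b)))"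

lemma across_in_arcs [simp]: "across b \<in> arcs G \<longleftrightarrow> b \<in> arcs G"
  by (simp add: across_def)

lemma white_across [simp]: "b \<in> arcs G \<Longrightarrow> white (across b) \<longleftrightarrow> \<not> white b"
  by (simp add: across_def)

lemma across_eq_iff [simp]: "across a = across b \<longleftrightarrow> a = b"
  by (simp add: across_def arev_eq_iff)

lemma nxt_across: "b \<in> arcs G \<Longrightarrow> nxt (across b) = arev (nxt b)"
  by (simp add: across_def)

lemma bij_across: "bij_betw across black (arcs G - black)"
proof -
  have "across ` black \<subseteq> arcs G - black" "across ` (arcs G - black) \<subseteq> black" "inj_on across S" for S
    by (auto simp: black_def inj_on_def)
  then show ?thesis by (intro bij_betw_if_mutual_inj[where g = across]) auto
qed

text \<open>Values lie in any abelian group because both real functions and free generators are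
  summed; with \<open>frag_of\<close> this is the relator of the face.\<close>

definition face_sum :: "('a \<Rightarrow> 'c::ab_group_add) \<Rightarrow> 'b \<Rightarrow> 'c" where
  "face_sum g a = g (tail G a) + g (tail G (nxt a)) + g (tail G (nxt (nxt a)))"

text \<open>Each neighbour of \<open>v\<close> lies in as many white as black faces at \<open>v\<close>, so both colours give
  the same total face sum at \<open>v\<close>.\<close>

lemma face_sums_at_vertex:
  fixes g :: "'a \<Rightarrow> 'c::ab_group_add"
  shows "(\<Sum>a\<in>black_out v. face_sum g a) = (\<Sum>a\<in>white_out v. face_sum g a)"
proof -
  have third: "tail G (nxt (nxt (rot a))) = head G a" if "a \<in> arcs G" for a
  proof -
    have "nxt (nxt (rot a)) = arev a" using that nxt_nxt_nxt[of "arev a"] by (simp add: nxt_arev)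
    then show ?thesis using that by simp
  qed
  have sum_rot: "(\<Sum>a\<in>black_out v. h (rot a)) = (\<Sum>a\<in>white_out v. h a)"
    "(\<Sum>a\<in>white_out v. h (rot a)) = (\<Sum>a\<in>black_out v. h a)" for h :: "'b \<Rightarrow> 'c"
    using bij_rot by (auto intro: sum.reindex_bij_betw)
  have split: "(\<Sum>a\<in>S. face_sum g a) = (\<Sum>a\<in>S. g v) + (\<Sum>a\<in>S. g (head G a)) + (\<Sum>a\<in>S. g (tail G (nxt (nxt a))))"
    if "S \<subseteq> out_arcs G v" for S
    using that unfolding sum.distrib[symmetric]
    by (intro sum.cong) (auto simp: face_sum_def)
  have b: "black_out v \<subseteq> out_arcs G v" and w: "white_out v \<subseteq> out_arcs G v"
    by (auto simp: black_out_def white_out_def)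
  have th: "(\<Sum>a\<in>S. g (tail G (nxt (nxt (rot a))))) = (\<Sum>a\<in>S. g (head G a))"
    if "S \<subseteq> out_arcs G v" for S
    using that third by (intro sum.cong) auto
  have "(\<Sum>a\<in>black_out v. g v) = (\<Sum>a\<in>white_out v. g v)"
    using sum_rot(1)[of "\<lambda>_. g v"] .
  moreover have "(\<Sum>a\<in>white_out v. g (tail G (nxt (nxt a)))) = (\<Sum>a\<in>black_out v. g (head G a))"
    using th[OF b] sum_rot(1)[of "\<lambda>a. g (tail G (nxt (nxt a)))"] by simp
  moreover have "(\<Sum>a\<in>black_out v. g (tail G (nxt (nxt a)))) = (\<Sum>a\<in>white_out v. g (head G a))"
    using th[OF w] sum_rot(2)[of "\<lambda>a. g (tail G (nxt (nxt a)))"] by simp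
  ultimately show ?thesis
    unfolding split[OF b] split[OF w] by (simp add: algebra_simps)
qed

text \<open>The faces of \<open>b\<close> and \<open>across b\<close> share an edge, whose two ends
  cancel.\<close>

lemma face_sum_across:
  assumes "b \<in> arcs G"
  shows "g (tail G b) - g (tail G (across b)) = face_sum g b - face_sum g (across b)"
proof -
  have "nxt (nxt (across b)) = nxt (arev (nxt b))" using assms by (simp add: nxt_across)
  then show ?thesis using assms by (simp add: face_sum_def nxt_across algebra_simps)
qed

text \<open>The right-hand side involves white faces only, so each Laplacian row is an integral
  combination of white relators.\<close>

lemma laplacian_eq_face_sums:
  fixes g :: "'a \<Rightarrow> 'c::ab_group_add"
  shows "(\<Sum>b\<in>black_out v. g v - g (tail G (across b)))
    = (\<Sum>a\<in>white_out v. face_sum g a) - (\<Sum>b\<in>black_out v. face_sum g (across b))"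
proof -
  have "(\<Sum>b\<in>black_out v. g v - g (tail G (across b)))
    = (\<Sum>b\<in>black_out v. face_sum g b - face_sum g (across b))"
    by (intro sum.cong) (auto simp: black_out_def face_sum_across[symmetric])
  then show ?thesis by (simp add: sum_subtractf face_sums_at_vertex)
qed

lemma sum_out_arcs: 
  "(\<Sum>a\<in>black. f a) = (\<Sum>v\<in>verts G. \<Sum>a\<in>black_out v. f a)"
  "(\<Sum>a\<in>arcs G - black. f a) = (\<Sum>v\<in>verts G. \<Sum>a\<in>white_out v. f a)"
proof -
  have b: "black_out v = {a \<in> black. tail G a = v}"
    and w: "white_out v = {a \<in> arcs G - black. tail G a = v}" for v
    by (auto simp: black_out_def white_out_def black_def)
  show "(\<Sum>a\<in>black. f a) = (\<Sum>v\<in>verts G. \<Sum>a\<in>black_out v. f a)"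
    unfolding b by (rule sum.group[symmetric]) (auto simp: black_def)
  show "(\<Sum>a\<in>arcs G - black. f a) = (\<Sum>v\<in>verts G. \<Sum>a\<in>white_out v. f a)"
    unfolding w by (rule sum.group[symmetric]) auto
qed

text \<open>Every vertex has as many white as black arcs, so in the digraph with an arc from
  \<open>tail G (across b)\<close> to \<open>tail G b\<close> for each black \<open>b\<close>, in-degrees and out-degrees agree.\<close>

lemma sum_across:
  fixes f :: "'a \<Rightarrow> 'c::comm_semiring_1"
  shows "(\<Sum>b\<in>black. f (tail G (across b))) = (\<Sum>b\<in>black. f (tail G b))"
proof -
  have "(\<Sum>b\<in>black. f (tail G (across b))) = (\<Sum>a\<in>arcs G - black. f (tail G a))"
    using sum.reindex_bij_betw[OF bij_across, of "\<lambda>a. f (tail G a)"] .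
  also have "\<dots> = (\<Sum>v\<in>verts G. \<Sum>a\<in>white_out v. f v)"
    unfolding sum_out_arcs(2) by (intro sum.cong) (auto simp: white_out_def)
  also have "\<dots> = (\<Sum>v\<in>verts G. \<Sum>a\<in>black_out v. f v)"
    by (simp add: card_out)
  also have "\<dots> = (\<Sum>b\<in>black. f (tail G b))"
    unfolding sum_out_arcs(1) by (intro sum.cong) (auto simp: black_out_def)
  finally show ?thesis .
qed

text \<open>\<open>g\<close> is harmonic for the across digraph; as this is Eulerian, the sum of the squares of the
  differences along its arcs vanishes.\<close>

lemma face_sum_zero_imp_across_eq:
  fixes g :: "'a \<Rightarrow> real"
  assumes zero: "\<And>a. a \<in> arcs G \<Longrightarrow> white a \<Longrightarrow> face_sum g a = 0" and b: "b \<in> black"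
  shows "g (tail G (across b)) = g (tail G b)"
proof -
  have harmonic: "(\<Sum>b\<in>black_out v. g v - g (tail G (across b))) = 0" for v
    unfolding laplacian_eq_face_sums
    by (auto simp: white_out_def black_out_def zero intro!: sum.neutral)
  have "(\<Sum>b\<in>black. g (tail G b) * (g (tail G b) - g (tail G (across b))))
    = (\<Sum>v\<in>verts G. \<Sum>b\<in>black_out v. g v * (g v - g (tail G (across b))))"
    unfolding sum_out_arcs(1) by (intro sum.cong) (auto simp: black_out_def)
  also have "\<dots> = 0" by (simp add: harmonic flip: sum_distrib_left)
  finally have 0: "(\<Sum>b\<in>black. g (tail G b) * (g (tail G b) - g (tail G (across b)))) = 0" .
  have "(\<Sum>b\<in>black. (g (tail G b) - g (tail G (across b)))\<^sup>2)
    = (\<Sum>b\<in>black. 2 * (g (tail G b) * (g (tail G b) - g (tail G (across b))))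
         + (g (tail G (across b)))\<^sup>2 - (g (tail G b))\<^sup>2)"
    by (intro sum.cong) (auto simp: power2_eq_square algebra_simps)
  also have "\<dots> = 2 * (\<Sum>b\<in>black. g (tail G b) * (g (tail G b) - g (tail G (across b))))
         + (\<Sum>b\<in>black. (g (tail G (across b)))\<^sup>2) - (\<Sum>b\<in>black. (g (tail G b))\<^sup>2)"
    by (simp only: sum.distrib sum_subtractf sum_distrib_left)
  also have "\<dots> = 0" using 0 sum_across[of "\<lambda>v. (g v)\<^sup>2"] by simp
  finally have "(\<Sum>b\<in>black. (g (tail G b) - g (tail G (across b)))\<^sup>2) = 0" .
  then have "(g (tail G b) - g (tail G (across b)))\<^sup>2 = 0"
    using b by (subst (asm) sum_nonneg_eq_0_iff) auto
  then show ?thesis by simp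
qed

text \<open>Together \<open>nxt\<close> and \<open>arev\<close> reach every arc: they compose to
  \<open>rot\<close>, which runs through all arcs at a vertex, and connectedness leads from vertex
  to vertex.\<close>

lemma arc_induct [consumes 2, case_names base nxt arev]:
  assumes a0: "a0 \<in> arcs G" and a: "a \<in> arcs G" and base: "P a0"
    and nxt: "\<And>a. a \<in> arcs G \<Longrightarrow> P a \<Longrightarrow> P (nxt a)"
    and arev: "\<And>a. a \<in> arcs G \<Longrightarrow> P a \<Longrightarrow> P (arev a)"
  shows "P a"
proof -
  have rot: "P (rot a)" if "a \<in> arcs G" "P a" for a
    using nxt[OF _ arev[OF that]] that by (simp add: nxt_arev)
  have around: "P c" if "b \<in> arcs G" "c \<in> arcs G" "tail G b = tail G c" "P b" for b c
  proof -
    have "cyclic_on rot (out_arcs G (tail G b))" using that by (intro rot_cyclic) auto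
    then have "c \<in> orbit rot b"
      using that by (subst orbit_cyclic_eq3[of rot "out_arcs G (tail G b)"]) auto
    then have "c \<in> arcs G \<and> P c"
      by induction (use rot that in auto)
    then show ?thesis ..
  qed
  have "tail G a0 \<rightarrow>\<^sup>*\<^bsub>G\<^esub> tail G a"
    using symmetric_connected_imp_strongly_connected[OF sym_arcs connected_graph] a a0
    by (auto simp: strongly_connected_def)
  then have "\<forall>b\<in>arcs G. tail G b = tail G a \<longrightarrow> P b"
  proof (induction rule: reachable_induct)
    case base
    then show ?case using around[OF a0] a0 assms(3) by auto
  next
    case (step x y)
    then obtain e where e: "e \<in> arcs G" "tail G e = x" "head G e = y" by auto
    then have "P (arev e)" using arev step by auto
    then show ?case using around[of "arev e"] e by auto
  qed
  then show ?thesis using a by auto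
qed

text \<open>The third vertices of the two faces at an edge have equal values, so both faces carry
  the same three values in opposite cyclic order. One white face thus determines all faces; if its
  values are distinct, this is a proper vertex 3-colouring.\<close>

lemma across_invariant:
  assumes inv: "\<And>b. b \<in> black \<Longrightarrow> f (tail G (across b)) = f (tail G b)"
    and a0: "a0 \<in> arcs G" "white a0" and a: "a \<in> arcs G"
    and xyz: "x = f (tail G a0)" "y = f (tail G (nxt a0))" "z = f (tail G (nxt (nxt a0)))"
  shows "(f (tail G a), f (tail G (nxt a)), f (tail G (nxt (nxt a)))) \<in>
    (if white a then {(x, y, z), (y, z, x), (z, x, y)} else {(y, x, z), (x, z, y), (z, y, x)})"
  using a0(1) a
proof (induction rule: arc_induct)
  case base
  then show ?case using a0 xyz by simp
next
  case (nxt a)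
  then show ?case by (auto split: if_splits)
next
  case (arev a)
  have *: "f (tail G (nxt (nxt (arev a)))) = f (tail G (nxt (nxt a)))"
  proof (cases "white a")
    case True
    then have "nxt (nxt (arev a)) \<in> black" using arev by (simp add: black_def)
    from inv[OF this] show ?thesis using arev by (simp add: across_def)
  next
    case False
    then have "nxt (nxt a) \<in> black" using arev by (simp add: black_def)
    from inv[OF this] show ?thesis using arev by (simp add: across_def)
  qed
  show ?case using arev * by (auto split: if_splits)
qed

end

section \<open>Three colours\<close>

text \<open>Zero rows pad the coefficients to a square matrix, which is then singular.\<close>

lemma underdetermined_system:
  fixes c :: "'i \<Rightarrow> 'j \<Rightarrow> 'a::field"
  assumes fin: "finite I" "finite J" and less: "card I < card J"
  obtains g where "\<exists>j\<in>J. g j \<noteq> 0" "\<And>i. i \<in> I \<Longrightarrow> (\<Sum>j\<in>J. c i j * g j) = 0"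
proof -
  let ?k = "card J"
  obtain e where e: "bij_betw e {0..<card I} I" using ex_bij_betw_nat_finite[OF fin(1)] by blast
  obtain h where h: "bij_betw h {0..<?k} J" using ex_bij_betw_nat_finite[OF fin(2)] by blast
  define B where "B = mat ?k ?k (\<lambda>(i, j). if i < card I then c (e i) (h j) else 0)"
  have B: "B \<in> carrier_mat ?k ?k" by (simp add: B_def)
  \<comment> \<open>Row \<open>card I\<close> of \<open>B\<close> is zero, so a unit vector lies in
    the kernel of the transpose.\<close>
  have "(\<Sum>j<?k. transpose_mat B $$ (i, j) * (if j = card I then 1 else 0)) = 0" if "i < ?k" for i
    using less that by (auto simp: B_def intro!: sum.neutral)
  then have "det (transpose_mat B) = 0"
    using B less by (subst det_eq_0_iff_kernel[of _ ?k])
      (auto intro!: exI[of _ "\<lambda>j. if j = card I then 1 else 0"])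
  then have "det B = 0" using det_transpose[OF B] by simp
  then obtain u where u: "\<exists>j<?k. u j \<noteq> 0" "\<And>i. i < ?k \<Longrightarrow> (\<Sum>j<?k. B $$ (i, j) * u j) = 0"
    using det_eq_0_iff_kernel[OF B] by blast
  define g where "g j = u (the_inv_into {0..<?k} h j)" for j
  have g: "g (h j) = u j" if "j < ?k" for j
    using h that by (simp add: g_def bij_betw_def the_inv_into_f_f)
  have "\<exists>j\<in>J. g j \<noteq> 0" using u(1) g h by (metis atLeast0LessThan bij_betw_apply lessThan_iff)
  moreover have "(\<Sum>j\<in>J. c i j * g j) = 0" if i: "i \<in> I" for i
  proof -
    obtain i' where i': "i' < card I" "i = e i'" using e i by (metis atLeast0LessThan bij_betw_iff_bijections lessThan_iff)
    have "(\<Sum>j\<in>J. c i j * g j) = (\<Sum>j\<in>{0..<?k}. c i (h j) * g (h j))"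
      by (rule sum.reindex_bij_betw[OF h, symmetric])
    also have "\<dots> = (\<Sum>j<?k. B $$ (i', j) * u j)"
      using i' less g by (intro sum.cong) (auto simp: B_def)
    finally show ?thesis using u(2)[of i'] i' less by simp
  qed
  ultimately show ?thesis using that by blast
qed

context face_2_coloured_spherical_triangulation
begin

section \<open>Counting faces, edges and vertices\<close>

lemma face_of_subset: "a \<in> arcs G \<Longrightarrow> face_of arev rot a \<subseteq> arcs G"
  by (simp add: face_of_conv)

lemma face_of_eq: 
  assumes "a \<in> arcs G" "x \<in> face_of arev rot a"
  shows "face_of arev rot x = face_of arev rot a"
proof -
  have "x \<in> {a, nxt a, nxt (nxt a)}" using assms(2) unfolding face_of_conv[OF assms(1)] .
  then show ?thesis by auto
qed

lemma self_in_face_of: "a \<in> face_of arev rot a"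
  by (simp add: face_of_eq_orbit self_in_orbit_nxt)

lemma finite_faces: "finite (faces G arev rot)"
  by (simp add: faces_def)

lemma card_arcs_faces: "3 * card (faces G arev rot) = card (arcs G)"
proof -
  have U: "\<Union> (faces G arev rot) = arcs G"
    using face_of_subset self_in_face_of by (auto simp: faces_def)
  have "3 * card (faces G arev rot) = card (\<Union> (faces G arev rot))"
  proof (rule card_partition)
    show "finite (\<Union> (faces G arev rot))" unfolding U by simp
    fix f f' assume f: "f \<in> faces G arev rot" "f' \<in> faces G arev rot" "f \<noteq> f'"
    show "f \<inter> f' = {}"
    proof (rule ccontr)
      assume "f \<inter> f' \<noteq> {}"
      then obtain x where "x \<in> f" "x \<in> f'" by blast
      then have "face_of arev rot x = f" "face_of arev rot x = f'"
        using f(1,2) face_of_eq by (auto simp: faces_def)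
      then show False using f(3) by simp
    qed
  qed (use finite_faces triangular in auto)
  then show ?thesis using U by simp
qed

lemma card_arcs_edges: "2 * card (edges G arev) = card (arcs G)"
proof -
  have U: "\<Union> (edges G arev) = arcs G" by (auto simp: edges_def)
  have "2 * card (edges G arev) = card (\<Union> (edges G arev))"
  proof (rule card_partition)
    show "finite (\<Union> (edges G arev))" unfolding U by simp
    fix e assume "e \<in> edges G arev"
    then obtain a where "a \<in> arcs G" "e = {a, arev a}" by (auto simp: edges_def)
    then show "card e = 2" using arev_neq[of a] by (simp add: card_insert_if)
  qed (auto simp: edges_def arev_eq_iff)
  then show ?thesis using U by simp
qed

text \<open>With \<open>t\<close> faces of each colour there are \<open>2 * t\<close> faces and
  \<open>3 * t\<close> edges, and Euler's formula leaves \<open>t + 2\<close> vertices.\<close>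

lemma card_verts:
  assumes "card (faces G arev rot - W) = card W"
  shows "card (verts G) = card W + 2"
proof -
  have "card (faces G arev rot) = 2 * card W"
    using assms white_faces finite_faces card_Diff_subset[of W "faces G arev rot"] 
      card_mono[of "faces G arev rot" W] finite_subset[of W] by simp
  then show ?thesis using euler card_arcs_faces card_arcs_edges by simp
qed

lemma sum_face: 
  assumes "a \<in> arcs G"
  shows "(\<Sum>x\<in>face_of arev rot a. g (tail G x)) = face_sum g a"
proof -
  have "nxt (nxt a) \<noteq> nxt a" using nxt_distinct(1)[of "nxt a"] assms by simp
  then have "a \<notin> {nxt a, nxt (nxt a)}" "nxt a \<notin> {nxt (nxt a)}"
    using assms nxt_distinct[OF assms] by auto
  then show ?thesis
    using assms by (simp add: face_of_conv face_sum_def add.assoc)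
qed

lemma obtain_out_arc:
  assumes "v \<in> verts G"
  obtains a where "a \<in> arcs G" "tail G a = v"
  using rot_cyclic[OF assms] by (metis cyclic_on_def in_out_arcs_conv)

lemma white_arc_exists:
  assumes "f \<in> W"
  obtains a where "a \<in> arcs G" "white a" "f = face_of arev rot a"
  using assms white_faces by (auto simp: faces_def white_def)

text \<open>The face equations leave a two-dimensional solution space, but functions
  that are constant on at most two classes would leave at most one dimension.\<close>

lemma three_colouring:
  assumes card: "card (faces G arev rot - W) = card W" and ne: "W \<noteq> {}"
  obtains g :: "'a \<Rightarrow> real" and a0 where "a0 \<in> arcs G" "white a0"
    "\<And>b. b \<in> black \<Longrightarrow> g (tail G (across b)) = g (tail G b)"
    "distinct [g (tail G a0), g (tail G (nxt a0)), g (tail G (nxt (nxt a0)))]"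
    "3 * card {v \<in> verts G. g v = g (tail G a0)} \<le> card (verts G)"
proof -
  note result = that
  obtain a0 where a0: "a0 \<in> arcs G" "white a0" using ne white_arc_exists by blast
  have finW: "finite W" using white_faces finite_faces finite_subset by blast
  \<comment> \<open>The white relations and the normalisation \<open>g (tail G a0) = 0\<close>,
    indexed by \<open>None\<close>, are one fewer than the vertices. A vertex counts as often as it
    occurs on the face.\<close>
  define c :: "'b set option \<Rightarrow> 'a \<Rightarrow> real" where "c i v = (case i of None \<Rightarrow> of_bool (v = tail G a0) 
    | Some f \<Rightarrow> real (card {a \<in> f. tail G a = v}))" for i v
  have "card (insert None (Some ` W)) < card (verts G)"
    using finW card_verts[OF card] by (subst card_insert_disjoint) (auto simp: card_image)
  then obtain g where g: "\<exists>v\<in>verts G. g v \<noteq> 0" 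
      "\<And>i. i \<in> insert None (Some ` W) \<Longrightarrow> (\<Sum>v\<in>verts G. c i v * g v) = 0"
    using underdetermined_system[of "insert None (Some ` W)" "verts G" c] finW by auto
  have "(\<Sum>v\<in>verts G. c None v * g v) = (\<Sum>v\<in>verts G. if v = tail G a0 then g v else 0)"
    by (intro sum.cong) (auto simp: c_def)
  then have x: "g (tail G a0) = 0"
    using g(2)[of None] a0 by simp
  have zero: "face_sum g a = 0" if a: "a \<in> arcs G" "white a" for a
  proof -
    let ?f = "face_of arev rot a"
    have f: "finite ?f" "?f \<subseteq> arcs G" using face_of_subset[OF a(1)] finite_subset[OF _ finite_arcs] by auto
    have "face_sum g a = (\<Sum>x\<in>?f. g (tail G x))" by (rule sum_face[OF a(1), symmetric])
    also have "\<dots> = (\<Sum>v\<in>verts G. \<Sum>x\<in>{x \<in> ?f. tail G x = v}. g (tail G x))"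
      using f by (intro sum.group[symmetric]) auto
    also have "\<dots> = (\<Sum>v\<in>verts G. c (Some ?f) v * g v)"
      by (intro sum.cong) (auto simp: c_def)
    finally show ?thesis using g(2)[of "Some ?f"] a(2) by (simp add: white_def)
  qed
  have inv: "g (tail G (across b)) = g (tail G b)" if "b \<in> black" for b
    using face_sum_zero_imp_across_eq[OF zero that] .
  define y where "y = g (tail G (nxt a0))"
  have z: "g (tail G (nxt (nxt a0))) = - y"
    using zero[OF a0] x unfolding face_sum_def y_def by simp
  have "g v \<in> {0, y, - y}" if v: "v \<in> verts G" for v
  proof -
    obtain a where "a \<in> arcs G" "tail G a = v" using obtain_out_arc[OF v] .
    then show ?thesis
      using across_invariant[of g, OF inv a0 _ x[symmetric] y_def z[symmetric]]
      by (fastforce split: if_splits)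
  qed
  note vals = this
  \<comment> \<open>For \<open>y = 0\<close> all three values, and so \<open>g\<close> on the
    vertices, would vanish.\<close>
  have y: "y \<noteq> 0" using g(1) vals by force
  define K where "K r = {v \<in> verts G. g v = r}" for r
  have "verts G = K 0 \<union> K y \<union> K (- y)" using vals by (auto simp: K_def)
  then have "card (verts G) = card (K 0 \<union> K y \<union> K (- y))" by simp
  also have "\<dots> = card (K 0) + card (K y) + card (K (- y))"
  proof -
    have "finite (K r)" for r by (simp add: K_def)
    moreover have "(K 0 \<union> K y) \<inter> K (- y) = {}" "K 0 \<inter> K y = {}" using y by (auto simp: K_def)
    ultimately show ?thesis by (simp add: card_Un_disjoint)
  qed
  finally have "3 * card (K 0) \<le> card (verts G) \<or> 3 * card (K y) \<le> card (verts G)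
    \<or> 3 * card (K (- y)) \<le> card (verts G)" by linarith
  \<comment> \<open>Any of the three classes becomes that of the tail of \<open>a0\<close> when
    \<open>a0\<close> is replaced by another arc of its face, so a smallest class can be
    chosen.\<close>
  moreover have thesis if r: "a \<in> {a0, nxt a0, nxt (nxt a0)}" "3 * card (K (g (tail G a))) \<le> card (verts G)" for a
  proof -
    have h: "g (head G a0) = y" "g (head G (nxt a0)) = - y" using a0 z by (simp_all add: y_def)
    have "distinct [g (tail G a), g (tail G (nxt a)), g (tail G (nxt (nxt a)))]"
      using r(1) a0(1) x y h by auto
    moreover have "a \<in> arcs G" "white a" using r(1) a0 by auto
    moreover have "3 * card {v \<in> verts G. g v = g (tail G a)} \<le> card (verts G)"
      using r(2) unfolding K_def .
    ultimately show thesis using result[of a g, OF _ _ inv] by blast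
  qed
  moreover from this[of a0] this[of "nxt a0"] this[of "nxt (nxt a0)"]
  have "3 * card (K (g (tail G a0))) \<le> card (verts G) \<Longrightarrow> thesis"
    "3 * card (K (g (tail G (nxt a0)))) \<le> card (verts G) \<Longrightarrow> thesis"
    "3 * card (K (g (tail G (nxt (nxt a0))))) \<le> card (verts G) \<Longrightarrow> thesis"
    by blast+
  ultimately show thesis unfolding x y_def[symmetric] z by blast
qed

lemma keys_face_sum: "a \<in> arcs G \<Longrightarrow> Poly_Mapping.keys (face_sum frag_of a) \<subseteq> verts G"
  unfolding face_sum_def by (intro order_trans[OF keys_add] Un_least) auto

text \<open>The quotient map followed by an isomorphism; it allows computing with combinations of
  vertices instead of cosets.\<close>

lemma canonical_group_presentation:
  assumes "canonical_group G W C"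
  obtains \<psi> where "\<psi> \<in> hom (free_Abelian_group (verts G)) (integer_group \<times>\<times> integer_group \<times>\<times> C)"
    "\<psi> ` carrier (free_Abelian_group (verts G)) = carrier (integer_group \<times>\<times> integer_group \<times>\<times> C)"
    "\<And>a. a \<in> arcs G \<Longrightarrow> white a \<Longrightarrow> \<psi> (face_sum frag_of a) = (0, 0, \<one>\<^bsub>C\<^esub>)"
proof -
  let ?F = "free_Abelian_group (verts G)" and ?P = "integer_group \<times>\<times> integer_group \<times>\<times> C"
  define Rel where "Rel = (\<lambda>f. \<Sum>a\<in>f. frag_of (tail G a) :: 'a \<Rightarrow>\<^sub>0 int) ` W"
  let ?N = "generate ?F Rel"
  interpret F: comm_group ?F by (rule abelian_free_Abelian_group)
  have Rel: "face_sum frag_of a \<in> Rel" if "a \<in> arcs G" "white a" for a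
    using that(2) unfolding Rel_def white_def sum_face[OF that(1), symmetric] by (rule imageI)
  have "Rel \<subseteq> carrier ?F"
  proof
    fix x assume "x \<in> Rel"
    then obtain f where f: "f \<in> W" "x = (\<Sum>a\<in>f. frag_of (tail G a))" by (auto simp: Rel_def)
    obtain a where a: "a \<in> arcs G" "f = face_of arev rot a" using white_arc_exists[OF f(1)] by metis
    then show "x \<in> carrier ?F" using keys_face_sum[of a] sum_face[of a frag_of] f(2) by simp
  qed
  then interpret N: normal ?N ?F
    by (simp add: F.normal_iff_subgroup F.generate_is_subgroup)
  obtain \<phi> where phi: "\<phi> \<in> iso (white_group G W) ?P"
    using assms by (auto simp: canonical_group_def is_iso_def)
  have wg: "white_group G W = ?F Mod ?N" by (simp add: white_group_def Rel_def)
  have proj: "(\<lambda>x. ?N #>\<^bsub>?F\<^esub> x) \<in> hom ?F (white_group G W)"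
    unfolding wg by (rule N.r_coset_hom_Mod)
  have P: "group ?P" using assms
    by (intro DirProd_group group_integer_group) (auto simp: canonical_group_def comm_group_def)
  show ?thesis
  proof
    show "\<phi> \<circ> (\<lambda>x. ?N #>\<^bsub>?F\<^esub> x) \<in> hom ?F ?P"
      using proj phi by (auto intro: hom_compose simp: iso_def)
    have "(\<lambda>x. ?N #>\<^bsub>?F\<^esub> x) ` carrier ?F = carrier (white_group G W)"
      unfolding wg by (auto simp: FactGroup_def RCOSETS_def)
    then show "(\<phi> \<circ> (\<lambda>x. ?N #>\<^bsub>?F\<^esub> x)) ` carrier ?F = carrier ?P"
      using phi unfolding image_comp[symmetric] by (simp add: iso_def bij_betw_def)
    fix a assume a: "a \<in> arcs G" "white a"
    then have "face_sum frag_of a \<in> ?N" using Rel by (intro generate.incl)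
    then have "?N #>\<^bsub>?F\<^esub> face_sum frag_of a = ?N"
      by (intro F.coset_join2 N.subgroup_axioms) (use keys_face_sum[OF a(1)] in auto)
    also have "?N = \<one>\<^bsub>white_group G W\<^esub>" by (simp add: wg FactGroup_def)
    also have "\<phi> \<dots> = \<one>\<^bsub>?P\<^esub>"
      using phi P group_white_group by (intro hom_one) (auto simp: iso_def)
    finally show "(\<phi> \<circ> (\<lambda>x. ?N #>\<^bsub>?F\<^esub> x)) (face_sum frag_of a) = (0, 0, \<one>\<^bsub>C\<^esub>)" by simp
  qed
qed

end

section \<open>The colour class of the root\<close>

locale three_coloured_triangulation = face_2_coloured_spherical_triangulation G arev rot W
  for G :: "('a, 'b) pre_digraph" and arev rot W +
  fixes g :: "'a \<Rightarrow> real" and a0 :: 'b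
  assumes a0: "a0 \<in> arcs G" "white a0"
    and g_across: "b \<in> black \<Longrightarrow> g (tail G (across b)) = g (tail G b)"
    and g_distinct: "distinct [g (tail G a0), g (tail G (nxt a0)), g (tail G (nxt (nxt a0)))]"
begin

definition root :: 'a where "root = tail G a0"
definition R :: "'a set" where "R = {v \<in> verts G. g v = g root}"

lemma root_in_R: "root \<in> R" and R_subset: "R \<subseteq> verts G" and finite_R: "finite R"
  using a0 by (auto simp: R_def root_def)

text \<open>The pair of \<open>g\<close> and \<open>f\<close> is invariant too, so it takes only the
  three values seen at the face of \<open>a0\<close>, which \<open>g\<close> tells apart.\<close>

lemma class_constant:
  assumes "\<And>b. b \<in> black \<Longrightarrow> f (tail G (across b)) = f (tail G b)" and v: "v \<in> R"
  shows "f v = f root"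
proof -
  obtain a where a: "a \<in> arcs G" "tail G a = v" using v R_subset obtain_out_arc by blast
  have "g v = g root" using v by (simp add: R_def)
  then show ?thesis
    using across_invariant[of "\<lambda>v. (g v, f v)", OF _ a0 a(1) refl refl refl] assms(1) g_across a(2) g_distinct
    by (auto simp: root_def split: if_splits)
qed

text \<open>Every face carries the three distinct values of \<open>g\<close> found at
  \<open>a0\<close>, so exactly one of its vertices has the value of the root.\<close>

lemma face_R:
  assumes "a \<in> arcs G"
  shows "(tail G a \<in> R \<and> tail G (nxt a) \<notin> R \<and> tail G (nxt (nxt a)) \<notin> R) \<or>
    (tail G a \<notin> R \<and> tail G (nxt a) \<in> R \<and> tail G (nxt (nxt a)) \<notin> R) \<or>
    (tail G a \<notin> R \<and> tail G (nxt a) \<notin> R \<and> tail G (nxt (nxt a)) \<in> R)"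
proof -
  have "tail G x \<in> R \<longleftrightarrow> g (tail G x) = g (tail G a0)" if "x \<in> arcs G" for x
    using that by (simp add: R_def root_def)
  then show ?thesis
    using across_invariant[of g, OF g_across a0 assms refl refl refl] assms g_distinct
    by (auto simp del: tail_nxt split: if_splits)
qed

lemma tail_across_in_R: "b \<in> arcs G \<Longrightarrow> tail G (across b) \<in> R \<longleftrightarrow> tail G b \<in> R"
proof (cases "white b")
  case False
  assume "b \<in> arcs G"
  then show ?thesis using g_across[of b] False by (simp add: R_def black_def)
next
  case True
  assume "b \<in> arcs G"
  have "across b \<in> black" using True \<open>b \<in> arcs G\<close> by (simp add: black_def)
  moreover have "across (across b) = b" using \<open>b \<in> arcs G\<close> by (simp add: across_def)
  ultimately show ?thesis using g_across[of "across b"] \<open>b \<in> arcs G\<close> by (simp add: R_def)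
qed

end

section \<open>The canonical group and the reduced Laplacian\<close>

lemma frag_cmul_card: "finite S \<Longrightarrow> (\<Sum>s\<in>S. x) = frag_cmul (int (card S)) x"
  by (induction S rule: finite_induct) (simp_all add: frag_cmul_distrib)

text \<open>The numbering \<open>r\<close> is also the order of elimination, which decides the last
  vertex of a closed walk.\<close>

locale reduced_laplacian = three_coloured_triangulation G arev rot W g a0
  for G :: "('a, 'b) pre_digraph" and arev rot W g a0 +
  fixes r :: "nat \<Rightarrow> 'a" and m :: nat
  assumes r: "bij_betw r {..<m} (R - {root})"
begin

lemma r_in: "k < m \<Longrightarrow> r k \<in> R" "k < m \<Longrightarrow> r k \<noteq> root"
  using bij_betw_apply[OF r] by auto

lemma r_eq_iff: "j < m \<Longrightarrow> k < m \<Longrightarrow> r j = r k \<longleftrightarrow> j = k"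
  using r by (auto simp: bij_betw_def inj_on_def)

text \<open>The arcs of the across digraph from \<open>r k\<close> to \<open>r i\<close>: rows of
  the Laplacian collect incoming arcs.\<close>

definition arcs_between :: "nat \<Rightarrow> nat \<Rightarrow> 'b set" where
  "arcs_between i k = {b \<in> black_out (r i). tail G (across b) = r k}"

definition laplacian :: "int mat" where
  "laplacian = mat m m (\<lambda>(i, k). (if i = k then int (card (black_out (r i))) else 0) - int (card (arcs_between i k)))"

definition comb :: "(nat \<Rightarrow> int) \<Rightarrow> 'a \<Rightarrow>\<^sub>0 int" where
  "comb e = (\<Sum>k<m. frag_cmul (e k) (frag_of (r k) - frag_of root))"

lemma comb_diff: "comb (\<lambda>k. u k - v k) = comb u - comb v"
  by (simp add: comb_def frag_cmul_diff_distrib sum_subtractf)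

lemma comb_zero [simp]: "comb (\<lambda>k. 0) = 0"
  by (simp add: comb_def)

lemma comb_cong: "(\<And>k. k < m \<Longrightarrow> u k = v k) \<Longrightarrow> comb u = comb v"
  by (simp add: comb_def)

lemma keys_comb: "Poly_Mapping.keys (comb e) \<subseteq> verts G"
proof -
  have "Poly_Mapping.keys (frag_of (r k) - frag_of root) \<subseteq> verts G" if "k < m" for k
    using r_in(1)[OF that] root_in_R R_subset by (intro order_trans[OF keys_diff]) auto
  then show ?thesis unfolding comb_def
    by (intro order_trans[OF keys_sum] UN_least order_trans[OF keys_cmul]) auto
qed

lemma comb_unit:
  assumes "v \<in> R"
  obtains e where "comb e = frag_of v - frag_of root"
proof (cases "v = root")
  case True
  then show ?thesis using that[of "\<lambda>_. 0"] by simp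
next
  case False
  then obtain k where k: "k < m" "v = r k" using assms r by (auto simp: bij_betw_def image_iff)
  have "comb (\<lambda>j. if j = k then 1 else 0) = (\<Sum>j<m. if j = k then frag_of (r k) - frag_of root else 0)"
    unfolding comb_def by (intro sum.cong) auto
  then show ?thesis using that k by simp
qed

text \<open>The black arcs at \<open>r i\<close> are grouped by the start of their across arc. All
  these starts lie in \<open>R\<close>, and a start at the root contributes the zero difference,
  which matches the deleted column.\<close>

lemma comb_laplacian_row:
  assumes i: "i < m"
  shows "comb (\<lambda>k. laplacian $$ (i, k)) = (\<Sum>b\<in>black_out (r i). frag_of (r i) - frag_of (tail G (across b)))"
proof -
  define u :: "'a \<Rightarrow> 'a \<Rightarrow>\<^sub>0 int" where "u v = frag_of v - frag_of root" for v
  let ?B = "black_out (r i)" and ?h = "\<lambda>b. tail G (across b)"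
  have h: "?h b \<in> R" if "b \<in> ?B" for b
    using that r_in(1)[OF i] tail_across_in_R[of b] by (auto simp: black_out_def)
  have "(\<Sum>k<m. frag_cmul (int (card (arcs_between i k))) (u (r k)))
      = (\<Sum>v\<in>R - {root}. frag_cmul (int (card {b \<in> ?B. ?h b = v})) (u v))"
    unfolding arcs_between_def by (rule sum.reindex_bij_betw[OF r])
  also have "\<dots> = (\<Sum>v\<in>R. frag_cmul (int (card {b \<in> ?B. ?h b = v})) (u v))"
    using finite_R by (intro sum.mono_neutral_left) (auto simp: u_def)
  also have "\<dots> = (\<Sum>v\<in>R. \<Sum>b\<in>{b \<in> ?B. ?h b = v}. u (?h b))"
    by (intro sum.cong) (auto simp flip: frag_cmul_card)
  also have "\<dots> = (\<Sum>b\<in>?B. u (?h b))"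
    using finite_R h by (intro sum.group) auto
  finally have 1: "(\<Sum>k<m. frag_cmul (int (card (arcs_between i k))) (u (r k))) = (\<Sum>b\<in>?B. u (?h b))" .
  have "comb (\<lambda>k. laplacian $$ (i, k)) = (\<Sum>k<m. (if k = i then frag_cmul (int (card ?B)) (u (r i)) else 0)
      - frag_cmul (int (card (arcs_between i k))) (u (r k)))"
    unfolding comb_def using i by (intro sum.cong) (auto simp: laplacian_def u_def frag_cmul_diff_distrib)
  also have "\<dots> = frag_cmul (int (card ?B)) (u (r i)) - (\<Sum>b\<in>?B. u (?h b))"
    using i 1 by (simp add: sum_subtractf)
  also have "\<dots> = (\<Sum>b\<in>?B. u (r i) - u (?h b))"
    by (simp add: sum_subtractf frag_cmul_card)
  also have "\<dots> = (\<Sum>b\<in>?B. frag_of (r i) - frag_of (?h b))" by (simp add: u_def)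
  finally show ?thesis .
qed

text \<open>The two vertices facing each other across an edge differ, modulo white relators, by a
  difference of two vertices of \<open>R\<close>, so the cosets of \<open>P\<close> are invariant under \<open>across\<close>.\<close>

lemma vertex_modulo:
  assumes zero: "P 0" and diff: "\<And>x y. P x \<Longrightarrow> P y \<Longrightarrow> P (x - y)"
    and rel: "\<And>a. a \<in> arcs G \<Longrightarrow> white a \<Longrightarrow> P (face_sum frag_of a)"
    and R: "\<And>v. v \<in> R \<Longrightarrow> P (frag_of v - frag_of root)"
    and v: "v \<in> verts G"
  shows "\<exists>u\<in>{tail G a0, tail G (nxt a0), tail G (nxt (nxt a0))}. P (frag_of v - frag_of u)"
proof -
  have plus: "P (x + y)" if "P x" "P y" for x y
    using diff[OF that(1) diff[OF zero that(2)]] by simp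
  \<comment> \<open>The coset of a vertex modulo \<open>P\<close>, so that
    \<open>across_invariant\<close> applies to \<open>\<kappa>\<close>.\<close>
  define \<kappa> where "\<kappa> v = {x. P (x - frag_of v)}" for v
  have kI: "\<kappa> u = \<kappa> v" if "P (frag_of u - frag_of v)" for u v
  proof -
    have "P (x - frag_of u) \<longleftrightarrow> P (x - frag_of v)" for x
      using plus[OF _ that, of "x - frag_of u"] diff[OF _ that, of "x - frag_of v"] by auto
    then show ?thesis by (simp add: \<kappa>_def)
  qed
  have kD: "P (frag_of u - frag_of v)" if "\<kappa> u = \<kappa> v" for u v
  proof -
    have "frag_of u \<in> \<kappa> u" using zero by (simp add: \<kappa>_def)
    then show ?thesis unfolding that by (simp add: \<kappa>_def)
  qed
  have RR: "P (frag_of u - frag_of v)" if "u \<in> R" "v \<in> R" for u v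
    using diff[OF R R, OF that] by simp
  have "\<kappa> (tail G (across b)) = \<kappa> (tail G b)" if b: "b \<in> black" for b
  proof -
    have bG: "b \<in> arcs G" "\<not> white b" using b by (auto simp: black_def)
    let ?u = "tail G (across b)"
    have ac: "nxt (across b) = arev (nxt b)" "nxt (nxt (across b)) = nxt (arev (nxt b))"
      using bG by (simp_all add: nxt_across)
    have S: "face_sum frag_of (across b) = frag_of ?u + frag_of (tail G (nxt (nxt b))) + frag_of (tail G (nxt b))"
      using bG by (simp add: face_sum_def ac)
    have Su: "P (face_sum frag_of (across b))" using rel bG by simp
    show ?thesis
    proof (cases "tail G b \<in> R")
      case True
      then show ?thesis using tail_across_in_R[of b] bG RR by (intro kI) auto
    next
      case False
      note nR = this
      \<comment> \<open>In both cases two white neighbours of the black face of \<open>b\<close>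
        share its other vertex outside \<open>R\<close>. One also contains \<open>?u\<close>, the
        other \<open>tail G b\<close>, and their third vertices lie in \<open>R\<close>. Subtracting
        the relators leaves \<open>?u\<close> minus \<open>tail G b\<close> up to a difference
        within \<open>R\<close>.\<close>
      then consider "tail G (nxt b) \<in> R" "tail G (nxt (nxt b)) \<notin> R" | "tail G (nxt b) \<notin> R" "tail G (nxt (nxt b)) \<in> R"
        using face_R[OF bG(1)] by blast
      then show ?thesis
      proof cases
        case 1
        let ?w = "arev (nxt (nxt b))"
        let ?p = "tail G (nxt (nxt ?w))"
        have w: "?w \<in> arcs G" "white ?w" using bG by simp_all
        have t: "tail G ?w = tail G b" "tail G (nxt ?w) = tail G (nxt (nxt b))" using bG by simp_all
        have p: "?p \<in> R" using face_R[OF w(1)] nR 1(2) unfolding t by blast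
        have "P (face_sum frag_of (across b) - face_sum frag_of ?w + (frag_of ?p - frag_of (tail G (nxt b))))"
          by (intro plus diff Su rel w RR p 1)
        then have "P (frag_of ?u - frag_of (tail G b))"
          unfolding S face_sum_def[of _ ?w] t by (simp add: algebra_simps)
        then show ?thesis by (rule kI)
      next
        case 2
        let ?w = "arev b"
        let ?p = "tail G (nxt (nxt ?w))"
        have w: "?w \<in> arcs G" "white ?w" using bG by simp_all
        have t: "tail G ?w = tail G (nxt b)" "tail G (nxt ?w) = tail G b" using bG by simp_all
        have p: "?p \<in> R" using face_R[OF w(1)] nR 2(1) unfolding t by blast
        have "P (face_sum frag_of (across b) - face_sum frag_of ?w + (frag_of ?p - frag_of (tail G (nxt (nxt b)))))"
          by (intro plus diff Su rel w RR p 2)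
        then have "P (frag_of ?u - frag_of (tail G b))"
          unfolding S face_sum_def[of _ ?w] t by (simp add: algebra_simps)
        then show ?thesis by (rule kI)
      qed
    qed
  qed
  note inv = this
  obtain a where a: "a \<in> arcs G" "tail G a = v" using obtain_out_arc[OF v] .
  have "\<kappa> v \<in> {\<kappa> (tail G a0), \<kappa> (tail G (nxt a0)), \<kappa> (tail G (nxt (nxt a0)))}"
    using across_invariant[of \<kappa>, OF inv a0 a(1) refl refl refl] a(2)
    by (simp del: tail_nxt split: if_splits; blast)
  then show ?thesis using kD by blast
qed

text \<open>Differences within \<open>R\<close> map into the finite part. Modulo them and the
  kernel, two vertices generate everything, and their integer coordinates are independent, so every
  element of \<open>C\<close> is the image of such a difference combination. The lattice of
  combinations in the kernel contains the Laplacian rows, which bounds its index.\<close>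

lemma order_canonical_group_le_det:
  assumes C: "canonical_group G W C" and det: "det laplacian \<noteq> 0"
  shows "int (order C) \<le> \<bar>det laplacian\<bar>"
proof -
  let ?F = "free_Abelian_group (verts G)" and ?P = "integer_group \<times>\<times> integer_group \<times>\<times> C"
  obtain \<psi> where hom: "\<psi> \<in> hom ?F ?P" and surj: "\<psi> ` carrier ?F = carrier ?P"
    and rel: "\<And>a. a \<in> arcs G \<Longrightarrow> white a \<Longrightarrow> \<psi> (face_sum frag_of a) = (0, 0, \<one>\<^bsub>C\<^esub>)"
    by (rule canonical_group_presentation[OF C]) (rule that)
  have CG: "group C" using C by (simp add: canonical_group_def comm_group_def)
  have PG: "group ?P" by (intro DirProd_group group_integer_group CG)
  interpret F: group ?F by simp
  interpret P: group ?P by (rule PG)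
  interpret C: group C by (rule CG)
  interpret psi: group_hom ?F ?P \<psi> using hom by unfold_locales
  define D where "D f \<longleftrightarrow> Poly_Mapping.keys f \<subseteq> verts G" for f :: "'a \<Rightarrow>\<^sub>0 int"
  have D_diff: "D (x - y)" if "D x" "D y" for x y
    using that keys_diff[of x y] by (auto simp: D_def)
  have D_of: "D (frag_of v)" if "v \<in> verts G" for v using that by (simp add: D_def)
  have D_comb: "D (comb e)" for e by (simp add: D_def keys_comb)
  define \<alpha> \<beta> \<gamma> where "\<alpha> f = fst (\<psi> f)" and "\<beta> f = fst (snd (\<psi> f))" and "\<gamma> f = snd (snd (\<psi> f))" for f
  have psi_eq: "\<psi> f = (\<alpha> f, \<beta> f, \<gamma> f)" for f by (simp add: \<alpha>_def \<beta>_def \<gamma>_def)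
  have \<gamma>C: "\<gamma> f \<in> carrier C" if "D f" for f
    using psi.hom_closed[of f] that by (auto simp: D_def psi_eq)
  have plus: "\<alpha> (x + y) = \<alpha> x + \<alpha> y" "\<beta> (x + y) = \<beta> x + \<beta> y" "\<gamma> (x + y) = \<gamma> x \<otimes>\<^bsub>C\<^esub> \<gamma> y" if "D x" "D y" for x y
    using psi.hom_mult[of x y] that by (auto simp: D_def psi_eq)
  have diff: "\<alpha> (x - y) = \<alpha> x - \<alpha> y" "\<beta> (x - y) = \<beta> x - \<beta> y" "\<gamma> (x - y) \<otimes>\<^bsub>C\<^esub> \<gamma> y = \<gamma> x" if "D x" "D y" for x y
    using plus[OF D_diff[OF that] that(2)] by auto
  have psi0: "\<psi> 0 = (0, 0, \<one>\<^bsub>C\<^esub>)" using psi.hom_one by simp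
  have D0: "D 0" by (simp add: D_def)
  define Ker where "Ker f \<longleftrightarrow> D f \<and> \<psi> f = (0, 0, \<one>\<^bsub>C\<^esub>)" for f
  have Ker_diff: "Ker (x - y)" if "Ker x" "Ker y" for x y
  proof -
    have xy: "D x" "D y" "\<gamma> x = \<one>\<^bsub>C\<^esub>" "\<gamma> y = \<one>\<^bsub>C\<^esub>" using that by (auto simp: Ker_def psi_eq)
    have "\<gamma> (x - y) = \<one>\<^bsub>C\<^esub>" using diff(3)[OF xy(1,2)] \<gamma>C[OF D_diff[OF xy(1,2)]] xy by simp
    then show ?thesis using that diff[OF xy(1,2)] D_diff[OF xy(1,2)] by (simp add: Ker_def psi_eq)
  qed
  have Ker0: "Ker 0" using psi0 D0 by (simp add: Ker_def)
  have Ker_rel: "Ker (face_sum frag_of a)" if "a \<in> arcs G" "white a" for a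
    using rel[OF that] keys_face_sum[OF that(1)] by (simp add: Ker_def D_def)
  have same: "\<psi> x = \<psi> y" if "Ker (x - y)" "D y" for x y
  proof -
    have "Ker (x - y)" "D (x - y)" using that by (auto simp: Ker_def)
    then show ?thesis using plus[of "x - y" y] that(2) \<gamma>C[OF that(2)] by (simp add: Ker_def psi_eq)
  qed

  define L where "L e \<longleftrightarrow> Ker (comb e)" for e
  interpret int_lattice m L
    by unfold_locales (auto simp: L_def Ker0 comb_diff Ker_diff cong: comb_cong)
  have "L (\<lambda>k. laplacian $$ (i, k))" if "i < m" for i
  proof -
    have sums: "Ker (\<Sum>a\<in>S. face_sum frag_of (h a))" if "\<And>a. a \<in> S \<Longrightarrow> h a \<in> arcs G \<and> white (h a)" for S and h :: "'b \<Rightarrow> 'b"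
      using that
    proof (induction S rule: infinite_finite_induct)
      case (insert x S)
      have "Ker (face_sum frag_of (h x) - (0 - (\<Sum>a\<in>S. face_sum frag_of (h a))))"
        using insert by (intro Ker_diff Ker0 Ker_rel) auto
      then show ?case using insert by simp
    qed (simp_all add: Ker0)
    show ?thesis
      unfolding L_def comb_laplacian_row[OF that] laplacian_eq_face_sums[of frag_of]
      by (intro Ker_diff sums) (auto simp: white_out_def black_out_def)
  qed
  then obtain S where S: "finite S" "int (card S) \<le> \<bar>det laplacian\<bar>" "\<And>v. \<exists>s\<in>S. L (\<lambda>k. v k - s k)"
    using index_le_det[of laplacian] det by (auto simp: laplacian_def)

  \<comment> \<open>Each integer coordinate is a real solution of the white relations, hence
    constant on \<open>R\<close>.\<close>
  have const: "\<alpha> (frag_of v) = \<alpha> (frag_of root) \<and> \<beta> (frag_of v) = \<beta> (frag_of root)" if "v \<in> R" for v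
  proof -
    have "real_of_int (h (frag_of v)) = real_of_int (h (frag_of root))"
      if h: "h = \<alpha> \<or> h = \<beta>" for h
    proof (rule class_constant[of "\<lambda>v. real_of_int (h (frag_of v))", OF _ \<open>v \<in> R\<close>], 
        rule face_sum_zero_imp_across_eq)
      fix a assume a: "a \<in> arcs G" "white a"
      have D: "D (frag_of (tail G a))" "D (frag_of (tail G (nxt a)))" "D (frag_of (tail G (nxt (nxt a))))"
          "D (frag_of (tail G a) + frag_of (tail G (nxt a)))"
        using a by (auto simp: D_of D_def intro!: order_trans[OF keys_add])
      have "\<alpha> (face_sum frag_of a) = 0" "\<beta> (face_sum frag_of a) = 0" using rel[OF a] by (auto simp: psi_eq)
      then show "face_sum (\<lambda>v. real_of_int (h (frag_of v))) a = 0"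
        using h D unfolding face_sum_def by (elim disjE) (simp_all add: plus flip: of_int_add)
    qed
    from this[of \<alpha>] this[of \<beta>] show ?thesis by simp
  qed
  have comb0: "\<alpha> (comb e) = 0 \<and> \<beta> (comb e) = 0" for e
  proof -
    define Q where "Q f \<longleftrightarrow> D f \<and> \<alpha> f = 0 \<and> \<beta> f = 0" for f
    have Q0: "Q 0" using psi0 D0 by (simp add: Q_def psi_eq)
    have Qd: "Q (x - y)" if "Q x" "Q y" for x y using that diff D_diff by (simp add: Q_def)
    have "Q (\<Sum>k\<in>S. frag_cmul (e k) (frag_of (r k) - frag_of root))" if "S \<subseteq> {..<m}" for S
      using that
    proof (induction S rule: infinite_finite_induct)
      case (insert k S)
      have "r k \<in> R" "r k \<in> verts G" "root \<in> verts G" using insert r_in R_subset root_in_R by auto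
      then have "Q (frag_of (r k) - frag_of root)"
        using diff const D_of D_diff by (simp add: Q_def)
      from Q0 Qd this have "Q (frag_cmul (e k) (frag_of (r k) - frag_of root))"
        by (rule frag_closure_minus_cmul[where P = Q])
      moreover have "Q (0 - (\<Sum>k\<in>S. frag_cmul (e k) (frag_of (r k) - frag_of root)))"
        using insert by (intro Qd[OF Q0]) simp
      ultimately have "Q (frag_cmul (e k) (frag_of (r k) - frag_of root) -
          (0 - (\<Sum>k\<in>S. frag_cmul (e k) (frag_of (r k) - frag_of root))))"
        by (rule Qd)
      then show ?case using insert by simp
    qed (simp_all add: Q0)
    from this[of "{..<m}"] show ?thesis by (simp add: Q_def comb_def)
  qed

  \<comment> \<open>The kernel enlarged by the differences within \<open>R\<close>.\<close>
  define \<Lambda> where "\<Lambda> f \<longleftrightarrow> (\<exists>e. Ker (f - comb e))" for f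
  have \<Lambda>_diff: "\<Lambda> (x - y)" if xy: "\<Lambda> x" "\<Lambda> y" for x y
  proof -
    obtain e e' where "Ker (x - comb e)" "Ker (y - comb e')" using xy by (auto simp: \<Lambda>_def)
    then have "Ker ((x - comb e) - (y - comb e'))" by (rule Ker_diff)
    then have "Ker ((x - y) - comb (\<lambda>k. e k - e' k))" by (simp add: comb_diff algebra_simps)
    then show ?thesis by (auto simp: \<Lambda>_def)
  qed
  have \<Lambda>_Ker: "\<Lambda> x" if "Ker x" for x
    unfolding \<Lambda>_def by (rule exI[of _ "\<lambda>_. 0"]) (simp add: that)
  have \<Lambda>_psi: "\<exists>e. \<psi> x = \<psi> (comb e)" if "\<Lambda> x" for x
    using that same D_comb by (auto simp: \<Lambda>_def)
  have \<Lambda>_plus: "\<Lambda> (x + y)" if "\<Lambda> x" "\<Lambda> y" for x y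
    using \<Lambda>_diff[OF that(1) \<Lambda>_diff[OF \<Lambda>_Ker[OF Ker0] that(2)]] by simp
  have \<Lambda>_R: "\<Lambda> (frag_of v - frag_of root)" if v: "v \<in> R" for v
  proof -
    obtain e where "comb e = frag_of v - frag_of root" using comb_unit[OF v] .
    then have "Ker (frag_of v - frag_of root - comb e)" by (simp add: Ker0)
    then show ?thesis unfolding \<Lambda>_def by (rule exI[of _ e])
  qed
  define c0 s0 where "c0 = tail G (nxt a0)" and "s0 = tail G (nxt (nxt a0))"
  have V0: "root \<in> verts G" "c0 \<in> verts G" using a0 by (auto simp: root_def c0_def)
  \<comment> \<open>Modulo \<open>\<Lambda>\<close> every vertex agrees with one of the face of
    \<open>a0\<close>, and the relator of that face eliminates \<open>s0\<close>.\<close>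
  have rep: "\<exists>p q. \<Lambda> (f - (frag_cmul p (frag_of root) + frag_cmul q (frag_of c0)))"
    if "D f" for f
  proof -
    have "Poly_Mapping.keys f \<subseteq> verts G" using that by (simp add: D_def)
    then show ?thesis
    proof (induction f rule: frag_induction)
      case zero
      show ?case by (rule exI[of _ 0], rule exI[of _ 0]) (simp add: \<Lambda>_Ker Ker0)
    next
      case (diff x y)
      then obtain p q p' q' where "\<Lambda> (x - (frag_cmul p (frag_of root) + frag_cmul q (frag_of c0)))"
          "\<Lambda> (y - (frag_cmul p' (frag_of root) + frag_cmul q' (frag_of c0)))" by blast
      then have "\<Lambda> ((x - (frag_cmul p (frag_of root) + frag_cmul q (frag_of c0)))
         - (y - (frag_cmul p' (frag_of root) + frag_cmul q' (frag_of c0))))" by (rule \<Lambda>_diff)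
      then have "\<Lambda> ((x - y) - (frag_cmul (p - p') (frag_of root) + frag_cmul (q - q') (frag_of c0)))"
        by (simp add: frag_cmul_diff_distrib algebra_simps)
      then show ?case by blast
    next
      case (one v)
      obtain u where u: "u \<in> {root, c0, s0}" and uv: "\<Lambda> (frag_of v - frag_of u)"
        using vertex_modulo[of \<Lambda>, OF _ \<Lambda>_diff _ \<Lambda>_R one] \<Lambda>_Ker Ker0 Ker_rel
        unfolding root_def c0_def s0_def by blast
      have "\<Lambda> (frag_of v - frag_of s0 + face_sum frag_of a0)" if "u = s0"
        using \<Lambda>_plus[OF uv \<Lambda>_Ker[OF Ker_rel[OF a0]]] unfolding that .
      then have "\<Lambda> (frag_of v - (frag_cmul (-1) (frag_of root) + frag_cmul (-1) (frag_of c0)))" if "u = s0"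
        using that by (simp add: face_sum_def root_def c0_def s0_def algebra_simps del: tail_nxt)
      moreover have "\<Lambda> (frag_of v - (frag_cmul 1 (frag_of root) + frag_cmul 0 (frag_of c0)))" if "u = root"
        using that uv by simp
      moreover have "\<Lambda> (frag_of v - (frag_cmul 0 (frag_of root) + frag_cmul 1 (frag_of c0)))" if "u = c0"
        using that uv by simp
      ultimately show ?case using u by blast
    qed
  qed
  define i0 j0 i1 j1 where "i0 = \<alpha> (frag_of root)" and "j0 = \<beta> (frag_of root)"
    and "i1 = \<alpha> (frag_of c0)" and "j1 = \<beta> (frag_of c0)"
  have D_cmul: "D (frag_cmul k x)" if "D x" for k x using that keys_cmul by (force simp: D_def)
  have D_plus: "D (x + y)" if "D x" "D y" for x y using that keys_add[of x y] by (auto simp: D_def)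
  have cmul: "\<alpha> (frag_cmul k x) = k * \<alpha> x \<and> \<beta> (frag_cmul k x) = k * \<beta> x" if x: "D x" for k x
  proof -
    have pos: "D (frag_cmul (int n) x) \<and> \<alpha> (frag_cmul (int n) x) = int n * \<alpha> x \<and> \<beta> (frag_cmul (int n) x) = int n * \<beta> x" for n
    proof (induction n)
      case (Suc n)
      then show ?case using plus[OF x D_cmul[OF x], of "int n"] D_plus[OF x D_cmul[OF x], of "int n"]
        by (simp add: frag_cmul_distrib distrib_right)
    qed (use psi0 D0 in \<open>simp add: psi_eq\<close>)
    show ?thesis
    proof (cases "k \<ge> 0")
      case True
      then show ?thesis using pos[of "nat k"] by simp
    next
      case False
      then have "frag_cmul k x = 0 - frag_cmul (int (nat (- k))) x" by simp
      then show ?thesis using diff[OF D0, of "frag_cmul (int (nat (- k))) x"] pos[of "nat (- k)"] False psi0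
        by (simp add: psi_eq)
    qed
  qed
  have coords: "\<exists>p q. \<Lambda> (f - (frag_cmul p (frag_of root) + frag_cmul q (frag_of c0)))
      \<and> \<alpha> f = p * i0 + q * i1 \<and> \<beta> f = p * j0 + q * j1" if "D f" for f
  proof -
    obtain p q where pq: "\<Lambda> (f - (frag_cmul p (frag_of root) + frag_cmul q (frag_of c0)))" (is "\<Lambda> (f - ?h)")
      using rep[OF \<open>D f\<close>] by blast
    obtain e where "\<psi> (f - ?h) = \<psi> (comb e)" using \<Lambda>_psi[OF pq] by blast
    then have "\<alpha> (f - ?h) = 0" "\<beta> (f - ?h) = 0" using comb0 by (auto simp: psi_eq)
    moreover have "D ?h" by (intro D_plus D_cmul D_of V0)
    moreover have "\<alpha> ?h = p * i0 + q * i1" "\<beta> ?h = p * j0 + q * j1"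
      using V0 by (simp_all add: plus cmul D_of D_cmul i0_def i1_def j0_def j1_def)
    ultimately show ?thesis using pq diff[OF that, of ?h] by auto
  qed
  have onto: "\<exists>f. D f \<and> \<psi> f = (i, j, c)" if "c \<in> carrier C" for i j c
  proof -
    have "(i, j, c) \<in> \<psi> ` carrier ?F" unfolding surj using that by simp
    then obtain x where "(i, j, c) = \<psi> x" "x \<in> carrier ?F" by (rule imageE)
    then have "D x \<and> \<psi> x = (i, j, c)" by (simp add: D_def)
    then show ?thesis by blast
  qed
  obtain f1 f2 where f1: "D f1" "\<psi> f1 = (1, 0, \<one>\<^bsub>C\<^esub>)" and f2: "D f2" "\<psi> f2 = (0, 1, \<one>\<^bsub>C\<^esub>)"
    using onto[OF C.one_closed] by blast
  obtain p q where pq: "1 = p * i0 + q * i1" "0 = p * j0 + q * j1"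
    using coords[OF f1(1)] f1(2) by (auto simp: psi_eq)
  obtain p' q' where pq': "0 = p' * i0 + q' * i1" "1 = p' * j0 + q' * j1"
    using coords[OF f2(1)] f2(2) by (auto simp: psi_eq)
  \<comment> \<open>Multiplicativity of the determinant: the coefficients of \<open>f1\<close> and
    \<open>f2\<close> times the coordinates of \<open>root\<close> and \<open>c0\<close> give the
    identity matrix.\<close>
  have "(p * q' - p' * q) * (i0 * j1 - i1 * j0) = (p * i0 + q * i1) * (p' * j0 + q' * j1) - (p * j0 + q * j1) * (p' * i0 + q' * i1)"
    by (simp add: algebra_simps)
  then have "(p * q' - p' * q) * (i0 * j1 - i1 * j0) = 1" unfolding pq[symmetric] pq'[symmetric] by simp
  then have indep: "i0 * j1 - i1 * j0 \<noteq> 0" by auto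
  \<comment> \<open>A preimage of an element of the finite part has zero integer coordinates, so
    independence removes its \<open>root\<close> and \<open>c0\<close> parts.\<close>
  have gen: "\<exists>e. \<gamma> (comb e) = c" if c: "c \<in> carrier C" for c
  proof -
    obtain f where f: "D f" "\<psi> f = (0, 0, c)" using onto[OF c] by blast
    obtain x y where xy: "\<Lambda> (f - (frag_cmul x (frag_of root) + frag_cmul y (frag_of c0)))"
        "x * i0 + y * i1 = 0" "x * j0 + y * j1 = 0"
      using coords[OF f(1)] f(2) by (auto simp: psi_eq)
    have "x * (i0 * j1 - i1 * j0) = (x * i0 + y * i1) * j1 - (x * j0 + y * j1) * i1"
      "y * (i0 * j1 - i1 * j0) = (x * j0 + y * j1) * i0 - (x * i0 + y * i1) * j0"
      by (simp_all add: algebra_simps)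
    then have "x = 0" "y = 0" using xy indep by auto
    then have "\<Lambda> f" using xy(1) by simp
    then obtain e where "\<psi> f = \<psi> (comb e)" using \<Lambda>_psi by blast
    then show ?thesis using f(2) by (auto simp: psi_eq)
  qed
  have "carrier C \<subseteq> (\<lambda>s. \<gamma> (comb s)) ` S"
  proof
    fix c assume "c \<in> carrier C"
    then obtain e where e: "\<gamma> (comb e) = c" using gen by blast
    obtain s where s: "s \<in> S" "L (\<lambda>k. e k - s k)" using S(3) by blast
    then have "Ker (comb e - comb s)" by (simp add: L_def comb_diff)
    then have "\<psi> (comb e) = \<psi> (comb s)" using same D_comb by blast
    then show "c \<in> (\<lambda>s. \<gamma> (comb s)) ` S" using e s(1) by (auto simp: psi_eq)
  qed
  then have "order C \<le> card S"
    unfolding order_def using S(1) by (rule surj_card_le[rotated])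
  then show ?thesis using S(2) by linarith
qed

end

section \<open>Closed walks of length three\<close>

lemma card_le_if_witnesses:
  assumes "finite T" and ex: "\<And>u. u \<in> S \<Longrightarrow> \<exists>t\<in>T. Q u t"
    and uniq: "\<And>u v t. u \<in> S \<Longrightarrow> v \<in> S \<Longrightarrow> t \<in> T \<Longrightarrow> Q u t \<Longrightarrow> Q v t \<Longrightarrow> u = v"
  shows "card S \<le> card T"
proof -
  obtain f where f: "\<And>u. u \<in> S \<Longrightarrow> f u \<in> T \<and> Q u (f u)" using ex by metis
  have "inj_on f S"
    using f uniq by (intro inj_onI) metis
  then show ?thesis using f assms(1) by (intro card_inj_on_le[of f]) auto
qed

context reduced_laplacian
begin

definition deg :: "nat \<Rightarrow> real" where "deg i = real (card (black_out (r i)))"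
definition adj :: "nat \<Rightarrow> nat \<Rightarrow> real" where "adj i j = real (card (arcs_between i j))"

lemma deg_pos: 
  assumes "i < m"
  shows "deg i > 0"
proof -
  have "r i \<in> verts G" using r_in(1)[OF assms] R_subset by auto
  then obtain a where "a \<in> arcs G" "tail G a = r i" by (rule obtain_out_arc)
  then have "out_degree G (r i) > 0" unfolding out_degree_def by (auto simp: card_gt_0_iff)
  then show ?thesis using card_out(2)[of "r i"] by (simp add: deg_def)
qed

text \<open>Moves a vector from indices to vertices, extended by zero, so that sums over indices
  become sums over black arcs.\<close>

lemma sum_adj:
  assumes k: "k \<le> m" and X: "\<And>j. j < k \<Longrightarrow> X (r j) = x j" "\<And>v. v \<notin> r ` {..<k} \<Longrightarrow> X v = 0"
  shows "(\<Sum>j<k. adj i j * x j) = (\<Sum>b\<in>black_out (r i). X (tail G (across b)))"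
proof -
  let ?B = "black_out (r i)" and ?h = "\<lambda>b. tail G (across b)" and ?U = "r ` {..<k}"
  have bij: "bij_betw r {..<k} ?U"
    using k r_eq_iff by (intro inj_on_imp_bij_betw inj_onI) auto
  have "(\<Sum>j<k. adj i j * x j) = (\<Sum>j<k. \<Sum>b\<in>{b \<in> ?B. ?h b = r j}. X (?h b))"
    using X(1) by (intro sum.cong) (auto simp: adj_def arcs_between_def)
  also have "\<dots> = (\<Sum>v\<in>?U. \<Sum>b\<in>{b \<in> ?B. ?h b = v}. X (?h b))"
    by (rule sum.reindex_bij_betw[OF bij])
  also have "\<dots> = (\<Sum>v\<in>?U. \<Sum>b\<in>{b \<in> {b \<in> ?B. ?h b \<in> ?U}. ?h b = v}. X (?h b))"
    by (intro sum.cong) auto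
  also have "\<dots> = (\<Sum>b\<in>{b \<in> ?B. ?h b \<in> ?U}. X (?h b))"
    by (intro sum.group) auto
  also have "\<dots> = (\<Sum>b\<in>?B. X (?h b))"
    using X(2) by (intro sum.mono_neutral_left) auto
  finally show ?thesis .
qed

text \<open>At a negative minimum, all in-neighbours attain the minimum too. The set where it is
  attained is then closed under arcs in both directions, and so contains the root.\<close>

lemma reduced_monotone:
  assumes k: "k \<le> m" and x: "\<And>i. i < k \<Longrightarrow> (\<Sum>j<k. adj i j * x j) \<le> deg i * x i" and i: "i < k"
  shows "x i \<ge> 0"
proof (rule ccontr)
  assume neg: "\<not> x i \<ge> 0"
  define \<mu> where "\<mu> = Min (x ` {..<k})"
  have min: "\<mu> \<le> x j" if "j < k" for j using that by (simp add: \<mu>_def)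
  have "\<mu> < 0" using min[OF i] neg by simp
  have "\<mu> \<in> x ` {..<k}" unfolding \<mu>_def using i by (intro Min_in) auto
  then obtain l where l: "l < k" "x l = \<mu>" by auto
  \<comment> \<open>The root and the vertices numbered from \<open>k\<close> on get 0, which exceeds
    the negative minimum.\<close>
  define X where "X v = (if v \<in> r ` {..<k} then x (the_inv_into {..<k} r v) else 0)" for v
  have inj: "inj_on r {..<k}" using k r_eq_iff by (intro inj_onI) auto
  have X: "X (r j) = x j" if "j < k" for j
    using that inj by (simp add: X_def the_inv_into_f_f)
  have X0: "X v = 0" if "v \<notin> r ` {..<k}" for v using that by (simp add: X_def)
  have X_min: "\<mu> \<le> X v" for v
  proof (cases "v \<in> r ` {..<k}")
    case True
    then show ?thesis using X min by auto
  next
    case False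
    then show ?thesis using X0 \<open>\<mu> < 0\<close> by simp
  qed
  define f :: "'a \<Rightarrow> real" where "f v = of_bool (X v = \<mu>)" for v
  have closed: "f (tail G b) \<le> f (tail G (across b))" if b: "b \<in> black" for b
  proof (cases "X (tail G b) = \<mu>")
    case True
    then have "tail G b \<in> r ` {..<k}" using X0 \<open>\<mu> < 0\<close> by force
    then obtain j where j: "j < k" "tail G b = r j" by auto
    have bB: "b \<in> black_out (r j)" using b j by (auto simp: black_def black_out_def)
    have "(\<Sum>b\<in>black_out (r j). X (tail G (across b))) \<le> deg j * x j"
      using x[OF j(1)] sum_adj[where X = X and x = x, OF k X X0, of j] by simp
    also have "\<dots> = (\<Sum>b\<in>black_out (r j). \<mu>)" using True X[OF j(1)] j(2) by (simp add: deg_def)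
    finally have le: "(\<Sum>b\<in>black_out (r j). X (tail G (across b)) - \<mu>) \<le> 0"
      by (simp add: sum_subtractf)
    moreover have "(\<Sum>b\<in>black_out (r j). X (tail G (across b)) - \<mu>) \<ge> 0"
      using X_min by (intro sum_nonneg) simp
    ultimately have "(\<Sum>b\<in>black_out (r j). X (tail G (across b)) - \<mu>) = 0" by simp
    then have "X (tail G (across b)) - \<mu> = 0"
      using X_min bB by (subst (asm) sum_nonneg_eq_0_iff) auto
    then show ?thesis by (simp add: f_def)
  qed (simp add: f_def)
  \<comment> \<open>The nonnegative terms sum to zero because the digraph is Eulerian, so all
    inequalities in \<open>closed\<close> are equalities.\<close>
  have "(\<Sum>b\<in>black. f (tail G (across b)) - f (tail G b)) = 0"
    using sum_across[of f] by (simp add: sum_subtractf)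
  then have "f (tail G (across b)) = f (tail G b)" if "b \<in> black" for b
    using that closed by (subst (asm) sum_nonneg_eq_0_iff) auto
  moreover have "r l \<in> R" using r_in(1)[of l] l(1) k by simp
  ultimately have "f (r l) = f root" by (rule class_constant)
  moreover have "f (r l) = 1" using X[OF l(1)] l(2) by (simp add: f_def)
  moreover have "root \<notin> r ` {..<k}" using r_in(2) k by (metis imageE lessThan_iff less_le_trans)
  then have "f root = 0" using X0[of root] \<open>\<mu> < 0\<close> by (simp add: f_def)
  ultimately show False by simp
qed

sublocale monotone_matrix m deg adj
  by unfold_locales (auto simp: adj_def deg_pos intro: reduced_monotone)

lemma det_laplacian: "det (leading m) = real_of_int (det laplacian)"
proof -
  have "leading m = map_mat real_of_int laplacian"
    by (rule eq_matI) (auto simp: leading_def laplacian_def deg_def adj_def)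
  then show ?thesis by (simp add: of_int_hom.hom_det)
qed

section \<open>Neighbours around a vertex\<close>

lemma nxt_nxt_rot: "a \<in> arcs G \<Longrightarrow> nxt (nxt (rot a)) = arev a"
  using nxt_nxt_nxt[of "arev a"] by (simp add: nxt_arev)

lemma across_arev: "a \<in> arcs G \<Longrightarrow> across (arev a) = nxt (rot (rot a))"
  by (simp add: across_def nxt_arev)

lemma across_nxt_rot_rot: "a \<in> arcs G \<Longrightarrow> across (nxt (rot (rot a))) = arev a"
  by (simp add: across_def nxt_nxt_rot)

text \<open>The tail of \<open>a\<close> and the heads of \<open>a\<close> and \<open>rot a\<close>
  form a face. Around a vertex outside \<open>R\<close>, membership in \<open>R\<close> therefore
  alternates among the neighbours.\<close>

lemma head_rot_in_R:
  assumes "a \<in> arcs G" "tail G a \<notin> R"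
  shows "head G (rot a) \<in> R \<longleftrightarrow> head G a \<notin> R"
  using face_R[of "rot a"] assms by (simp add: nxt_nxt_rot) blast

end

locale near_homogeneous_laplacian = reduced_laplacian G arev rot W g a0 r m
  for G :: "('a, 'b) pre_digraph" and arev rot W g a0 r m +
  assumes near_homogeneous: "near_homogeneous G" and graph: "graph G"
begin

lemma arc_unique: "a \<in> arcs G \<Longrightarrow> b \<in> arcs G \<Longrightarrow> tail G a = tail G b \<Longrightarrow> head G a = head G b \<Longrightarrow> a = b"
proof -
  interpret graph G by (rule graph)
  show "a \<in> arcs G \<Longrightarrow> b \<in> arcs G \<Longrightarrow> tail G a = tail G b \<Longrightarrow> head G a = head G b \<Longrightarrow> a = b"
    by (rule no_multi_arcs) (auto simp: arc_to_ends_def)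
qed

lemma out_degree_le: "v \<in> verts G \<Longrightarrow> out_degree G v \<le> 6"
  using near_homogeneous by (fastforce simp: near_homogeneous_def)

lemma deg_le: "i < m \<Longrightarrow> deg i \<le> 3"
  using out_degree_le[of "r i"] r_in(1)[of i] R_subset card_out(2)[of "r i"] by (auto simp: deg_def)

text \<open>The vertices that contribute a closed walk of length three with last vertex \<open>r l\<close>.\<close>

definition good :: "nat \<Rightarrow> 'a set" where
  "good l = {u \<in> verts G - R. out_degree G u = 6 \<and> (\<exists>a\<in>out_arcs G u. head G a = r l) \<and>
     (\<forall>a\<in>out_arcs G u. head G a \<in> R \<longrightarrow> (\<exists>i\<le>l. head G a = r i))}"

text \<open>The arcs are recorded with the indices, so that parallel across arcs count separately as
  in \<open>adj\<close>.\<close>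

definition triangles :: "nat \<Rightarrow> ((nat \<times> nat) \<times> 'b \<times> 'b \<times> 'b) set" where
  "triangles l = (SIGMA ij:{..<l} \<times> {..<l}. arcs_between l (fst ij) \<times> arcs_between (fst ij) (snd ij) \<times> arcs_between (snd ij) l)"

lemma card_triangles: "real (card (triangles l)) = (\<Sum>i<l. \<Sum>j<l. adj l i * adj i j * adj j l)"
  unfolding triangles_def
  by (subst card_SigmaI)
    (auto simp: arcs_between_def adj_def sum.cartesian_product card_cartesian_product case_prod_beta mult.assoc)

lemma rot6:
  assumes u: "u \<in> verts G" "out_degree G u = 6" and a: "a \<in> out_arcs G u"
  shows "rot (rot (rot (rot (rot (rot a))))) = a" "rot (rot a) \<noteq> a" 
    "rot (rot (rot (rot a))) \<noteq> a" "rot (rot (rot (rot a))) \<noteq> rot (rot a)"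
proof -
  have o: "orbit rot a = out_arcs G u" by (rule orbit_cyclic_eq3[OF rot_cyclic[OF u(1)] a])
  have self: "a \<in> orbit rot a" unfolding o by (rule a)
  have c: "card (orbit rot a) = 6" using u(2) unfolding o out_degree_def .
  have "(rot ^^ 6) a = a" using orbit_funpow_card(1)[OF self] unfolding c .
  then show "rot (rot (rot (rot (rot (rot a))))) = a" by (simp add: eval_nat_numeral)
  have inj: "inj_on (\<lambda>n. (rot ^^ n) a) {..<6}" using orbit_funpow_card(3)[OF self] unfolding c .
  show "rot (rot a) \<noteq> a" using inj_onD[OF inj, of 2 0] by (auto simp: eval_nat_numeral)
  show "rot (rot (rot (rot a))) \<noteq> a" using inj_onD[OF inj, of 4 0] by (auto simp: eval_nat_numeral)
  show "rot (rot (rot (rot a))) \<noteq> rot (rot a)" using inj_onD[OF inj, of 4 2] by (auto simp: eval_nat_numeral)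
qed

text \<open>Every second neighbour of \<open>u\<close> lies in \<open>R\<close>, and across arcs
  join these three cyclically. In a simple graph only one of them is \<open>r l\<close>, so the
  other two have smaller numbers. The last conclusion allows \<open>u\<close> to be recovered from
  the walk.\<close>

lemma good_triangle:
  assumes l: "l < m" and u: "u \<in> good l"
  obtains i j b1 b2 b3 where "((i, j), b1, b2, b3) \<in> triangles l" "b1 \<noteq> b2" "b1 \<in> arcs G" "b2 \<in> arcs G"
    "head G b1 = u \<and> head G b2 = u \<or> head G (nxt b1) = u \<and> head G (nxt b2) = u"
proof -
  have uV: "u \<in> verts G" "u \<notin> R" "out_degree G u = 6" using u by (auto simp: good_def)
  obtain a where a: "a \<in> out_arcs G u" "head G a = r l" using u by (auto simp: good_def)
  define a2 a4 where "a2 = rot (rot a)" and "a4 = rot (rot (rot (rot a)))"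
  have aG: "a \<in> arcs G" "a2 \<in> arcs G" "a4 \<in> arcs G" "tail G a = u" "tail G a2 = u" "tail G a4 = u"
    using a by (auto simp: a2_def a4_def)
  have rr: "rot (rot a) = a2" "rot (rot a2) = a4" "rot (rot a4) = a"
    using rot6(1)[OF uV(1,3) a(1)] by (simp_all add: a2_def a4_def)
  have ne: "a2 \<noteq> a" "a4 \<noteq> a" "a4 \<noteq> a2"
    using rot6(2-4)[OF uV(1,3) a(1)] by (simp_all add: a2_def a4_def)
  have step: "head G (rot (rot x)) \<in> R \<longleftrightarrow> head G x \<in> R" if "x \<in> arcs G" "tail G x = u" for x
    using head_rot_in_R[of x] head_rot_in_R[of "rot x"] that uV(2) by simp
  have "head G a \<in> R" using a(2) r_in(1)[OF l] by simp
  then have inR: "head G a2 \<in> R" "head G a4 \<in> R"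
    using step[OF aG(1,4)] step[OF aG(2,5)] rr by simp_all
  have idx: "\<exists>i<l. head G x = r i" if x: "x \<in> arcs G" "tail G x = u" "head G x \<in> R" "x \<noteq> a" for x
  proof -
    obtain i where i: "i \<le> l" "head G x = r i" using u x by (auto simp: good_def)
    have "i \<noteq> l" using arc_unique[of x a] x aG a(2) i(2) by auto
    then show ?thesis using i by (intro exI[of _ i]) simp
  qed
  obtain i where i: "i < l" "head G a2 = r i" using idx[OF aG(2,5) inR(1) ne(1)] by blast
  obtain j where j: "j < l" "head G a4 = r j" using idx[OF aG(3,6) inR(2) ne(2)] by blast
  show ?thesis
  \<comment> \<open>The colour of \<open>a\<close> decides in which sense the walk runs around
    \<open>u\<close>.\<close>
  proof (cases "white a")
    case True
    then have w: "white a2" "white a4" using aG by (simp_all add: a2_def a4_def)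
    have "((i, j), arev a, arev a2, arev a4) \<in> triangles l"
      using i j a(2) aG True w
      by (simp add: triangles_def arcs_between_def black_out_def across_arev rr)
    then show ?thesis
      by (rule that) (use aG ne in \<open>auto simp: arev_eq_iff\<close>)
  next
    case False
    then have w: "\<not> white a2" "\<not> white a4" using aG by (simp_all add: a2_def a4_def)
    have ac: "across (nxt a) = arev a4" "across (nxt a2) = arev a" "across (nxt a4) = arev a2"
      using across_nxt_rot_rot aG rr by metis+
    have "((j, i), nxt a, nxt a4, nxt a2) \<in> triangles l"
      using i j a(2) aG False w
      by (simp add: triangles_def arcs_between_def black_out_def ac)
    then show ?thesis
      by (rule that) (use aG ne in auto)
  qed
qed

text \<open>A walk determines \<open>u\<close>: if \<open>b1\<close> and \<open>b2\<close> had a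
  common head and \<open>nxt b1\<close> and \<open>nxt b2\<close> another, the latter two would be
  parallel arcs.\<close>

lemma card_good_le: 
  assumes l: "l < m"
  shows "card (good l) \<le> card (triangles l)"
proof -
  define Q where "Q u t \<longleftrightarrow> (case t of (ij :: nat \<times> nat, b1, b2, b3 :: 'b) \<Rightarrow> b1 \<noteq> b2 \<and> b1 \<in> arcs G \<and> b2 \<in> arcs G \<and>
      (head G b1 = u \<and> head G b2 = u \<or> head G (nxt b1) = u \<and> head G (nxt b2) = u))" for u t
  show ?thesis
  proof (rule card_le_if_witnesses[where Q = Q])
    show "finite (triangles l)"
      by (auto simp: triangles_def arcs_between_def)
    show "\<exists>t\<in>triangles l. Q u t" if u: "u \<in> good l" for u
    proof -
      obtain i j b1 b2 b3 where "((i, j), b1, b2, b3) \<in> triangles l" "b1 \<noteq> b2" "b1 \<in> arcs G" "b2 \<in> arcs G"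
          "head G b1 = u \<and> head G b2 = u \<or> head G (nxt b1) = u \<and> head G (nxt b2) = u"
        by (rule good_triangle[OF l u])
      then show ?thesis by (intro bexI[of _ "((i, j), b1, b2, b3)"]) (auto simp: Q_def)
    qed
    show "u = v" if "Q u t" "Q v t" for u v t
    proof -
      obtain ij b1 b2 b3 where t: "t = (ij, b1, b2, b3)" by (cases t) auto
      have b: "b1 \<noteq> b2" "b1 \<in> arcs G" "b2 \<in> arcs G" using \<open>Q u t\<close> by (auto simp: Q_def t)
      have "\<not> (head G b1 = head G b2 \<and> head G (nxt b1) = head G (nxt b2))"
        using arc_unique[of "nxt b1" "nxt b2"] b by auto
      then show ?thesis using that by (auto simp: Q_def t)
    qed
  qed
qed

lemma pivot_le:
  assumes l: "l < m"
  shows "deg l - (\<Sum>i<l. \<Sum>j<l. adj l i * adj i j * adj j l / (deg i * deg j)) \<le> 3 * (26 / 27) ^ card (good l)"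
proof -
  \<comment> \<open>The 9 is \<open>3 * 3\<close>, as \<open>deg\<close> is half an out-degree of at
    most six.\<close>
  have "(\<Sum>i<l. \<Sum>j<l. adj l i * adj i j * adj j l / 9)
      \<le> (\<Sum>i<l. \<Sum>j<l. adj l i * adj i j * adj j l / (deg i * deg j))"
  proof (intro sum_mono divide_left_mono)
    fix i j assume "i \<in> {..<l}" "j \<in> {..<l}"
    then have "i < m" "j < m" using l by auto
    then show "deg i * deg j \<le> 9" "0 < 9 * (deg i * deg j)"
      using deg_le deg_pos mult_mono[of "deg i" 3 "deg j" 3] by (auto simp: less_imp_le)
  qed (auto simp: adj_def)
  moreover have "real (card (good l)) \<le> (\<Sum>i<l. \<Sum>j<l. adj l i * adj i j * adj j l)"
    using card_good_le[OF l] card_triangles[of l] by simp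
  ultimately have "deg l - (\<Sum>i<l. \<Sum>j<l. adj l i * adj i j * adj j l / (deg i * deg j))
      \<le> 3 * (1 + real (card (good l)) * (- 1 / 27))"
    using deg_le[OF l] by (simp add: sum_divide_distrib[symmetric])
  \<comment> \<open>In this form the product of the bounds depends only on the total number of good
    vertices.\<close>
  also have "\<dots> \<le> 3 * (1 + (- 1 / 27)) ^ card (good l)"
    by (intro mult_left_mono Bernoulli_inequality) auto
  finally show ?thesis by simp
qed

lemma det_laplacian_le:
  "0 < det laplacian" "real_of_int (det laplacian) \<le> 3 ^ m * (26 / 27) ^ (\<Sum>l<m. card (good l))"
proof -
  show "0 < det laplacian" using det_leading_le(1)[of m] det_laplacian by simp
  have nonneg: "0 \<le> deg l - (\<Sum>i<l. \<Sum>j<l. adj l i * adj i j * adj j l / (deg i * deg j))" if "l < m" for l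
    using det_leading_Suc[OF that] by (smt (verit))
  have "det (leading m) \<le> (\<Prod>l<m. deg l - (\<Sum>i<l. \<Sum>j<l. adj l i * adj i j * adj j l / (deg i * deg j)))"
    by (rule det_leading_le(2)) simp
  also have "\<dots> \<le> (\<Prod>l<m. 3 * (26 / 27) ^ card (good l))"
    using nonneg pivot_le by (intro prod_mono) auto
  also have "\<dots> = 3 ^ m * (26 / 27) ^ (\<Sum>l<m. card (good l))"
    by (simp add: prod.distrib power_sum)
  finally show "real_of_int (det laplacian) \<le> 3 ^ m * (26 / 27) ^ (\<Sum>l<m. card (good l))"
    by (simp add: det_laplacian)
qed

text \<open>A vertex of degree six that is neither in \<open>R\<close> nor adjacent to the root is
  good for its highest-numbered neighbour in \<open>R\<close>. The exceptions are the
  \<open>m + 1\<close> vertices of \<open>R\<close>, six of degree four and at most six neighbours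
  of the root.\<close>

lemma card_good_ge: "card (verts G) \<le> (\<Sum>l<m. card (good l)) + m + 13"
proof -
  let ?near = "head G ` out_arcs G root" and ?four = "{v \<in> verts G. out_degree G v = 4}"
  have cover: "verts G \<subseteq> (\<Union>l<m. good l) \<union> R \<union> ?four \<union> ?near"
  proof
    fix u assume u: "u \<in> verts G"
    show "u \<in> (\<Union>l<m. good l) \<union> R \<union> ?four \<union> ?near"
    proof (rule ccontr)
      assume n: "u \<notin> (\<Union>l<m. good l) \<union> R \<union> ?four \<union> ?near"
      then have u6: "out_degree G u = 6" using near_homogeneous u by (auto simp: near_homogeneous_def)
      define I where "I = {i. i < m \<and> (\<exists>a\<in>out_arcs G u. head G a = r i)}"
      have I: "\<exists>i\<in>I. head G a = r i" if a: "a \<in> out_arcs G u" "head G a \<in> R" for a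
      proof -
        have "head G a \<noteq> root"
        proof
          assume "head G a = root"
          then have "arev a \<in> out_arcs G root" "head G (arev a) = u" using a by auto
          then show False using n by blast
        qed
        then obtain i where i: "i < m" "head G a = r i" using a(2) r by (auto simp: bij_betw_def image_iff)
        then have "i \<in> I" using a(1) unfolding I_def by blast
        then show ?thesis using i(2) by blast
      qed
      obtain a where a: "a \<in> arcs G" "tail G a = u" using obtain_out_arc[OF u] .
      have "head G a \<in> R \<or> head G (rot a) \<in> R" using head_rot_in_R[of a] a n by blast
      then have "I \<noteq> {}" using I[of a] I[of "rot a"] a by auto
      moreover have "finite I" by (simp add: I_def)
      ultimately have M: "Max I \<in> I" "\<And>i. i \<in> I \<Longrightarrow> i \<le> Max I" by auto
      have "Max I < m" "\<exists>a\<in>out_arcs G u. head G a = r (Max I)" using M(1) unfolding I_def by blast+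
      moreover have "\<forall>a\<in>out_arcs G u. head G a \<in> R \<longrightarrow> (\<exists>i\<le>Max I. head G a = r i)"
        using I M(2) by blast
      ultimately have "u \<in> good (Max I)" unfolding good_def using u u6 n by blast
      then show False using n \<open>Max I < m\<close> by blast
    qed
  qed
  have "card (verts G) \<le> card ((\<Union>l<m. good l) \<union> R \<union> ?four \<union> ?near)"
    using cover finite_R by (intro card_mono) (auto simp: good_def)
  also have "\<dots> \<le> card (\<Union>l<m. good l) + card R + card ?four + card ?near"
    by (meson add_le_mono1 card_Un_le order_trans)
  also have "\<dots> \<le> (\<Sum>l<m. card (good l)) + (m + 1) + 6 + 6"
  proof (intro add_mono)
    show "card (\<Union>l<m. good l) \<le> (\<Sum>l<m. card (good l))" by (rule card_UN_le) simp
    have "card (R - {root}) = m" using bij_betw_same_card[OF r] by simp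
    then show "card R \<le> m + 1" by (simp add: card_Diff_singleton_if split: if_splits)
    show "card ?four \<le> 6" using near_homogeneous by (simp add: near_homogeneous_def)
    have "card ?near \<le> out_degree G root" unfolding out_degree_def by (intro card_image_le finite_subset[OF _ finite_arcs]) auto
    then show "card ?near \<le> 6" using out_degree_le[of root] root_in_R R_subset by auto
  qed
  finally show ?thesis by simp
qed

end

section \<open>The growth rate\<close>

lemma bound_as_exponential:
  fixes x t :: real and m s :: nat
  assumes x: "x \<le> 3 ^ m * (26 / 27) ^ s" and s: "t + 2 \<le> real s + real m + 13" and m: "3 * (real m + 1) \<le> t + 2"
  shows "x \<le> 3 powr (- 1 / 3) * (26 / 27) powr (- 32 / 3) * ((3 * (26 / 27)\<^sup>2) powr (1 / 3)) powr t"
proof -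
  have "3 ^ m * (26 / 27) ^ s = 3 powr real m * (26 / 27) powr real s"
    by (simp add: powr_realpow)
  \<comment> \<open>Here \<open>m\<close> is at most \<open>(t - 1) / 3\<close>, and then
    \<open>s\<close> is at least \<open>(2 * t - 32) / 3\<close>; the base \<open>26 / 27\<close>
    reverses the inequality.\<close>
  also have "\<dots> \<le> 3 powr ((t - 1) / 3) * (26 / 27) powr ((2 * t - 32) / 3)"
    using s m by (intro mult_mono powr_mono powr_mono') auto
  also have "3 powr ((t - 1) / 3) = 3 powr (- 1 / 3) * 3 powr (t / 3)"
    by (simp add: diff_divide_distrib flip: powr_add)
  also have "(26 / 27) powr ((2 * t - 32) / 3) = (26 / 27 :: real) powr (- 32 / 3) * (26 / 27) powr (2 * t / 3)"
    by (simp add: diff_divide_distrib flip: powr_add)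
  also have "(26 / 27 :: real) powr (2 * t / 3) = ((26 / 27)\<^sup>2) powr (t / 3)"
    by (simp add: powr_powr flip: powr_numeral)
  finally show ?thesis using x by (simp add: powr_mult powr_powr mult_ac)
qed

lemma (in face_2_coloured_spherical_triangulation) order_canonical_group_le:
  assumes nh: "near_homogeneous G" and gr: "graph G" and C: "canonical_group G W C"
    and t: "card W = t" "card (faces G arev rot - W) = t" "t > 0"
  shows "real (order C) \<le> 3 powr (- 1 / 3) * (26 / 27) powr (- 32 / 3) * ((3 * (26 / 27)\<^sup>2) powr (1 / 3)) powr real t"
proof -
  have "card (faces G arev rot - W) = card W" "W \<noteq> {}" using t by auto
  then obtain g :: "'a \<Rightarrow> real" and a0 where g: "a0 \<in> arcs G" "white a0"
    "\<And>b. b \<in> black \<Longrightarrow> g (tail G (across b)) = g (tail G b)"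
    "distinct [g (tail G a0), g (tail G (nxt a0)), g (tail G (nxt (nxt a0)))]"
    "3 * card {v \<in> verts G. g v = g (tail G a0)} \<le> card (verts G)"
    using three_colouring by blast
  interpret three_coloured_triangulation G arev rot W g a0
    by unfold_locales (use g in auto)
  define m where "m = card (R - {root})"
  obtain r where r: "bij_betw r {..<m} (R - {root})"
    using ex_bij_betw_nat_finite[of "R - {root}"] finite_R by (auto simp: m_def lessThan_atLeast0)
  interpret near_homogeneous_laplacian G arev rot W g a0 r m
    by (intro near_homogeneous_laplacian.intro reduced_laplacian.intro reduced_laplacian_axioms.intro
        near_homogeneous_laplacian_axioms.intro three_coloured_triangulation_axioms r nh gr)
  have "card R = m + 1" using card_Suc_Diff1[OF finite_R root_in_R] unfolding m_def by simp
  then have "3 * (m + 1) \<le> t + 2"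
    using g(5) card_verts t by (simp add: R_def root_def)
  then have "real (3 * (m + 1)) \<le> real (t + 2)" by (rule of_nat_mono)
  then have m: "3 * (real m + 1) \<le> real t + 2" by simp
  have "t + 2 \<le> (\<Sum>l<m. card (good l)) + m + 13" using card_good_ge card_verts t by simp
  then have "real (t + 2) \<le> real ((\<Sum>l<m. card (good l)) + m + 13)" by (rule of_nat_mono)
  then have s: "real t + 2 \<le> real (\<Sum>l<m. card (good l)) + real m + 13" by simp
  have "int (order C) \<le> \<bar>det laplacian\<bar>"
    using order_canonical_group_le_det[OF C] det_laplacian_le(1) by simp
  then have "real (order C) \<le> real_of_int (det laplacian)" using det_laplacian_le(1) by linarith
  also note det_laplacian_le(2)
  finally show ?thesis using s m by (rule bound_as_exponential)
qed

lemma max_canonical_order_le: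
  assumes "t > 0"
  shows "real (max_canonical_order t) \<le> 3 powr (- 1 / 3) * (26 / 27) powr (- 32 / 3) * ((3 * (26 / 27)\<^sup>2) powr (1 / 3)) powr real t"
    (is "_ \<le> ?B")
proof -
  define S where "S = {order C | (C :: nat monoid) (G :: (nat, nat) pre_digraph) arev rot W.
            face_2_coloured_spherical_triangulation G arev rot W \<and>
            near_homogeneous G \<and> graph G \<and>
            card W = t \<and> card (faces G arev rot - W) = t \<and>
            canonical_group G W C}"
  have le: "real n \<le> ?B" if "n \<in> S" for n
    using that assms face_2_coloured_spherical_triangulation.order_canonical_group_le
    unfolding S_def by blast
  have "real (Sup S) \<le> ?B"
  proof (cases "S = {}")
    \<comment> \<open>Without any such triangulation the supremum has its default value 0.\<close>
    case True
    then show ?thesis by (simp add: Sup_nat_def)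
  next
    case False
    have "n \<le> nat \<lfloor>?B\<rfloor>" if "n \<in> S" for n using le[OF that] by linarith
    then have "Sup S \<le> nat \<lfloor>?B\<rfloor>" using False by (intro cSup_least) auto
    then show ?thesis by (simp add: le_nat_iff le_floor_iff)
  qed
  then show ?thesis by (simp add: max_canonical_order_def S_def)
qed

theorem theorem3p4:
  "limsup (\<lambda>t. ereal (real (max_canonical_order t) powr (1 / real t)))
     < ereal (exp (ln 3 - 2 / 27) powr (1 / 3)) \<and>
   exp (ln 3 - 2 / 27) powr (1 / 3) < (1.4071 :: real)"
proof
  \<comment> \<open>The factor \<open>K\<close> disappears under the root, since
    \<open>K powr (1 / real t)\<close> tends to 1.\<close>
  define K b :: real where "K = 3 powr (- 1 / 3) * (26 / 27) powr (- 32 / 3)"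
    and "b = (3 * (26 / 27)\<^sup>2) powr (1 / 3)"
  have K: "K > 0" and b: "b > 0" by (simp_all add: K_def b_def)
  have "real (max_canonical_order t) powr (1 / real t) \<le> K powr (1 / real t) * b" if t: "t > 0" for t
  proof -
    have "real (max_canonical_order t) powr (1 / real t) \<le> (K * b powr real t) powr (1 / real t)"
      using max_canonical_order_le[OF t] unfolding K_def b_def by (intro powr_mono2) auto
    also have "\<dots> = K powr (1 / real t) * b"
      using t K b by (simp add: powr_mult powr_powr)
    finally show ?thesis .
  qed
  then have "limsup (\<lambda>t. ereal (real (max_canonical_order t) powr (1 / real t)))
      \<le> limsup (\<lambda>t. ereal (K powr (1 / real t) * b))"
    by (intro Limsup_mono eventually_mono[OF eventually_gt_at_top[of 0]]) auto
  also have "\<dots> = ereal b"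
  proof (rule lim_imp_Limsup)
    have "(\<lambda>t. K powr (1 / real t) * b) \<longlonglongrightarrow> K powr 0 * b"
      using K by (intro tendsto_intros lim_1_over_n) auto
    then show "(\<lambda>t. ereal (K powr (1 / real t) * b)) \<longlonglongrightarrow> ereal b"
      using K by simp
  qed simp
  also have "ereal b < ereal (exp (ln 3 - 2 / 27) powr (1 / 3))"
  proof -
    \<comment> \<open>Strictness of \<open>1 - x < exp (- x)\<close> makes the first inequality
      strict.\<close>
    have "26 / 27 < exp (- 1 / 27 :: real)"
      using exp_minus_greater[of "1 / 27"] by simp
    then have "(26 / 27)\<^sup>2 < (exp (- 1 / 27 :: real))\<^sup>2" by (intro power_strict_mono) auto
    also have "\<dots> = exp (- 2 / 27)" by (simp flip: exp_double)
    finally have "3 * (26 / 27)\<^sup>2 < 3 * exp (- 2 / 27 :: real)" by (rule mult_strict_left_mono) simp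
    also have "\<dots> = exp (ln 3 - 2 / 27)" using exp_add[of "ln 3" "- 2 / 27 :: real"] by simp
    finally have "b < exp (ln 3 - 2 / 27) powr (1 / 3)" unfolding b_def by (intro powr_less_mono2) auto
    then show ?thesis by simp
  qed
  finally show "limsup (\<lambda>t. ereal (real (max_canonical_order t) powr (1 / real t)))
     < ereal (exp (ln 3 - 2 / 27) powr (1 / 3))" .
  \<comment> \<open>The quadratic Taylor bound at \<open>1 / 27\<close>, squared, bounds
    \<open>exp (2 / 27)\<close> closely enough for
    \<open>3 < 1.4071 ^ 3 * exp (2 / 27)\<close>.\<close>
  have "(1 + 1 / 27 + (1 / 27)\<^sup>2 / 2)\<^sup>2 \<le> (exp (1 / 27 :: real))\<^sup>2"
    by (intro power_mono exp_lower_Taylor_quadratic) auto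
  also have "\<dots> = exp (2 / 27)" by (simp flip: exp_double)
  finally have "3 < 1.4071 ^ 3 * exp (2 / 27 :: real)" by (simp add: power2_eq_square power3_eq_cube)
  then have "3 / exp (2 / 27 :: real) < 1.4071 ^ 3" by (simp add: divide_less_eq)
  then have "exp (ln 3 - 2 / 27 :: real) < 1.4071 ^ 3" using exp_diff[of "ln 3" "2 / 27 :: real"] by simp
  then have "exp (ln 3 - 2 / 27 :: real) powr (1 / 3) < (1.4071 ^ 3) powr (1 / 3)"
    by (intro powr_less_mono2) auto
  also have "\<dots> = (1.4071 :: real)" by (simp add: powr_powr flip: powr_numeral)
  finally show "exp (ln 3 - 2 / 27) powr (1 / 3) < (1.4071 :: real)" .
qed

end
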